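(* Let $M,N$ be two $n$-dimensional flat manifolds, and let $\sigma:N\to M$ be a map such that the composition operator $Tf=f\circ\sigma$ defines a bijective linear map $T:\mathrm{Lip}^{\mathrm{pt}}(M)\to\mathrm{Lip}^{\mathrm{pt}}(N)$ satisfying $L^{\mathrm{pt}}_x(Tf)=L^{\mathrm{pt}}_{\sigma(x)}(f)$ for all $f\in\mathrm{Lip}^{\mathrm{pt}}(M)$ and all $x\in N$ (resp. a bijective linear map $T:\mathrm{Lip}^{\mathrm{loc}}(M)\to\mathrm{Lip}^{\mathrm{loc}}(N)$ satisfying $L^{\mathrm{loc}}_x(Tf)=L^{\mathrm{loc}}_{\sigma(x)}(f)$ for all $f\in\mathrm{Lip}^{\mathrm{loc}}(M)$ and all $x\in N$). Then $\sigma$ is a local isometry in the following sense: for any point $p\in N$ and any charts $\phi:U\to M$ of $\sigma(p)$ and $\psi:V\to N$ of $p$ such that $\sigma(\psi(V))\subseteq\phi(U)$, the induced map $\phi^{-1}\circ\sigma\circ\psi:V\to U$ is an isometry.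
   Context: A flat manifold of dimension $n$ is a set $M$ with a family of injective maps, called charts, $\phi_\alpha:U_\alpha\subseteq\mathbb{R}^n\to\phi_\alpha(U_\alpha)\subseteq M$, where each $U_\alpha$ is an open connected set containing $0$, such that: (1) $M\subseteq\bigcup_\alpha\phi_\alpha(U_\alpha)$; (2) for any $\alpha,\beta$ with $W=\phi_\alpha(U_\alpha)\cap\phi_\beta(U_\beta)\neq\emptyset$, the transition map $\phi_\alpha^{-1}\circ\phi_\beta|_{\phi_\beta^{-1}(W)}$ is a diffeomorphism from $\phi_\beta^{-1}(W)$ onto $\phi_\alpha^{-1}(W)$, and its derivative $D[\phi_\alpha^{-1}\circ\phi_\beta]$ is an orthogonal matrix at every point; (3) the family $\{(U_\alpha,\phi_\alpha)\}_\alpha$ is maximal with respect to (1) and (2). A chart of a point $p$ (a chart at $p$) is a chart $\phi_p:U\to M$ with $\phi_p(0)=p$. For $g:U\to\mathbb{R}$ with $U\subseteq\mathbb{R}^n$ open and $0\in U$, $L^{\mathrm{loc}}_0(g)=\lim_{\epsilon\to0^+}\sup_{x\neq y\in B(0,\epsilon)\cap U}\frac{|g(x)-g(y)|}{\|x-y\|}$ and $L^{\mathrm{pt}}_0(g)=\limsup_{x\to0}\frac{|g(x)-g(0)|}{\|x\|}$ (Euclidean norm). A function $f:M\to\mathbb{R}$ is locally (resp. pointwise) Lipschitz if for every $p\in M$ there is a chart $\phi_p$ at $p$ with $L^{\mathrm{loc}}_0(f\circ\phi_p)<+\infty$ (resp. $L^{\mathrm{pt}}_0(f\circ\phi_p)<+\infty$);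 one sets $L^{\mathrm{loc}}_p(f)=L^{\mathrm{loc}}_0(f\circ\phi_p)$ (resp. $L^{\mathrm{pt}}_p(f)=L^{\mathrm{pt}}_0(f\circ\phi_p)$), which does not depend on the choice of chart at $p$. $\mathrm{Lip}^{\mathrm{loc}}(M)$ and $\mathrm{Lip}^{\mathrm{pt}}(M)$ denote the real vector spaces of locally, resp. pointwise, Lipschitz functions $M\to\mathbb{R}$. An isometry is a distance-preserving map (here for the Euclidean distances on $V,U\subseteq\mathbb{R}^n$), not assumed surjective.
   Formalization: Both flat manifolds M and N are assumed Hausdorff (in the topology given by their charts), the usual convention for manifolds; conditions (1)–(3) alone do not imply it, and without it the statement is false. *)

theory Defs
  imports "HOL-Analysis.Analysis"
begin

section \<open>Diffeomorphisms\<close>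

primrec Ck_on :: "nat \<Rightarrow> 'a::real_normed_vector set \<Rightarrow> ('a \<Rightarrow> 'b::real_normed_vector) \<Rightarrow> bool" where
  "Ck_on 0 S f \<longleftrightarrow> continuous_on S f"
| "Ck_on (Suc k) S f \<longleftrightarrow>
     (\<forall>x\<in>S. f differentiable (at x)) \<and> (\<forall>v. Ck_on k S (\<lambda>x. frechet_derivative f (at x) v))"

definition smooth_on :: "'a::real_normed_vector set \<Rightarrow> ('a \<Rightarrow> 'b::real_normed_vector) \<Rightarrow> bool" where
  "smooth_on S f \<longleftrightarrow> (\<forall>k. Ck_on k S f)"

definition diffeomorphism ::
  "'a::real_normed_vector set \<Rightarrow> 'b::real_normed_vector set \<Rightarrow> ('a \<Rightarrow> 'b) \<Rightarrow> bool" where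
  "diffeomorphism S T f \<longleftrightarrow>
     open S \<and> open T \<and> bij_betw f S T \<and> smooth_on S f \<and> smooth_on T (inv_into S f)"


section \<open>Flat manifolds\<close>

text \<open>A chart is a pair of a domain and a map that is \<^term>\<open>undefined\<close> outside the domain, so
  that equality of pairs is equality of partial maps.\<close>

type_synonym ('a, 'n) chart = "(real ^ 'n) set \<times> (real ^ 'n \<Rightarrow> 'a)"

definition is_chart :: "'a set \<Rightarrow> ('a, 'n::finite) chart \<Rightarrow> bool" where
  "is_chart M = (\<lambda>(U, \<phi>). open U \<and> connected U \<and> 0 \<in> U \<and> \<phi> \<in> U \<rightarrow>\<^sub>E M \<and> inj_on \<phi> U)"

definition flat_compatible :: "('a, 'n::finite) chart \<Rightarrow> ('a, 'n) chart \<Rightarrow> bool" where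
  "flat_compatible = (\<lambda>(U, \<phi>) (V, \<psi>).
     let W = \<phi> ` U \<inter> \<psi> ` V; \<tau> = (\<lambda>x. inv_into U \<phi> (\<psi> x)) in
       W \<noteq> {} \<longrightarrow>
         diffeomorphism {x \<in> V. \<psi> x \<in> W} {y \<in> U. \<phi> y \<in> W} \<tau> \<and>
         (\<forall>x. x \<in> V \<and> \<psi> x \<in> W \<longrightarrow> orthogonal_matrix (jacobian \<tau> (at x))))"

definition flat_preatlas :: "'a set \<Rightarrow> ('a, 'n::finite) chart set \<Rightarrow> bool" where
  "flat_preatlas M A \<longleftrightarrow>
     (\<forall>c\<in>A. is_chart M c) \<and>
     M \<subseteq> (\<Union>(U, \<phi>)\<in>A. \<phi> ` U) \<and>
     (\<forall>c\<in>A. \<forall>d\<in>A. flat_compatible c d)"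

definition flat_atlas :: "'a set \<Rightarrow> ('a, 'n::finite) chart set \<Rightarrow> bool" where
  "flat_atlas M A \<longleftrightarrow> flat_preatlas M A \<and> (\<forall>B. flat_preatlas M B \<and> A \<subseteq> B \<longrightarrow> B = A)"

definition flat_topology :: "'a set \<Rightarrow> ('a, 'n::finite) chart set \<Rightarrow> 'a topology" where
  "flat_topology M A = topology (\<lambda>S. S \<subseteq> M \<and> (\<forall>(U, \<phi>)\<in>A. open {x \<in> U. \<phi> x \<in> S}))"

lemma openin_flat_topology:
  fixes A :: "('a, 'n::finite) chart set"
  shows "openin (flat_topology M A) S \<longleftrightarrow> S \<subseteq> M \<and> (\<forall>(U, \<phi>)\<in>A. open {x \<in> U. \<phi> x \<in> S})"
proof -
  have "istopology (\<lambda>S. S \<subseteq> M \<and> (\<forall>(U, \<phi>)\<in>A. open {x \<in> U. \<phi> x \<in> S}))"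
    unfolding istopology_def
  proof (intro conjI allI impI)
    fix S T
    assume S: "S \<subseteq> M \<and> (\<forall>(U, \<phi>)\<in>A. open {x \<in> U. \<phi> x \<in> S})"
      and T: "T \<subseteq> M \<and> (\<forall>(U, \<phi>)\<in>A. open {x \<in> U. \<phi> x \<in> T})"
    show "S \<inter> T \<subseteq> M" using S by blast
    have "open {x \<in> U. \<phi> x \<in> S \<inter> T}" if "(U, \<phi>) \<in> A" for U \<phi>
    proof -
      have "{x \<in> U. \<phi> x \<in> S \<inter> T} = {x \<in> U. \<phi> x \<in> S} \<inter> {x \<in> U. \<phi> x \<in> T}" by blast
      then show ?thesis using S T that by (auto intro!: open_Int)
    qed
    then show "\<forall>(U, \<phi>)\<in>A. open {x \<in> U. \<phi> x \<in> S \<inter> T}" by blast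
  next
    fix K
    assume K: "\<forall>S\<in>K. S \<subseteq> M \<and> (\<forall>(U, \<phi>)\<in>A. open {x \<in> U. \<phi> x \<in> S})"
    then show "\<Union>K \<subseteq> M" by blast
    have "open {x \<in> U. \<phi> x \<in> \<Union>K}" if "(U, \<phi>) \<in> A" for U \<phi>
    proof -
      have "{x \<in> U. \<phi> x \<in> \<Union>K} = (\<Union>S\<in>K. {x \<in> U. \<phi> x \<in> S})" by blast
      moreover have "open {x \<in> U. \<phi> x \<in> S}" if "S \<in> K" for S
        using K that \<open>(U, \<phi>) \<in> A\<close> by blast
      ultimately show ?thesis by (metis (no_types, lifting) open_UN)
    qed
    then show "\<forall>(U, \<phi>)\<in>A. open {x \<in> U. \<phi> x \<in> \<Union>K}" by blast
  qed
  then show ?thesis by (simp add: flat_topology_def)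
qed

text \<open>Manifolds are Hausdorff by the usual convention, which conditions (1)-(3) on the charts,
  i.e. \<^const>\<open>flat_atlas\<close>, do not imply and which the theorem needs. Indeed, adjoin to the line
  an extra point \<open>r\<^sub>t\<close> for each \<open>t\<close> in \<open>(-1, 1)\<close>, whose punctured
  neighbourhoods consist of a punctured right neighbourhood of \<open>2 + t\<close> and a punctured left neighbourhood of
  \<open>6 + t\<close>. Every continuous function then satisfies \<open>f(2 + t) = f(6 + t)\<close>, so exchanging
  the points 2 and 6 preserves all functions and all Lipschitz constants, but it is not an isometry
  in the chart given by the line.\<close>

definition flat_manifold :: "'a set \<Rightarrow> ('a, 'n::finite) chart set \<Rightarrow> bool" where
  "flat_manifold M A \<longleftrightarrow> flat_atlas M A \<and> Hausdorff_space (flat_topology M A)"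

definition charts_at :: "('a, 'n::finite) chart set \<Rightarrow> 'a \<Rightarrow> ('a, 'n) chart set" where
  "charts_at A p = {(U, \<phi>) \<in> A. \<phi> 0 = p}"


section \<open>Lipschitz constants and Lipschitz functions\<close>

text \<open>The constants take values in the extended reals. Only values of \<^term>\<open>g\<close> on
  \<^term>\<open>U\<close> matter.\<close>

definition Lloc0 :: "(real ^ 'n::finite) set \<Rightarrow> (real ^ 'n \<Rightarrow> real) \<Rightarrow> ereal" where
  "Lloc0 U g = Lim (at_right (0::real)) (\<lambda>\<epsilon>.
     SUP (x, y) \<in> {(x, y). x \<in> ball 0 \<epsilon> \<inter> U \<and> y \<in> ball 0 \<epsilon> \<inter> U \<and> x \<noteq> y}.
       ereal (\<bar>g x - g y\<bar> / norm (x - y)))"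

definition Lpt0 :: "(real ^ 'n::finite) set \<Rightarrow> (real ^ 'n \<Rightarrow> real) \<Rightarrow> ereal" where
  "Lpt0 U g = Limsup (at 0 within U) (\<lambda>x. ereal (\<bar>g x - g 0\<bar> / norm x))"

text \<open>The constants at a point are taken in some chart at that point; they do not depend on the
  choice.\<close>

definition Lloc :: "('a, 'n::finite) chart set \<Rightarrow> 'a \<Rightarrow> ('a \<Rightarrow> real) \<Rightarrow> ereal" where
  "Lloc A p f = (let (U, \<phi>) = (SOME c. c \<in> charts_at A p) in Lloc0 U (f \<circ> \<phi>))"

definition Lpt :: "('a, 'n::finite) chart set \<Rightarrow> 'a \<Rightarrow> ('a \<Rightarrow> real) \<Rightarrow> ereal" where
  "Lpt A p f = (let (U, \<phi>) = (SOME c. c \<in> charts_at A p) in Lpt0 U (f \<circ> \<phi>))"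

text \<open>Functions on \<^term>\<open>M\<close> are represented by functions that are \<^term>\<open>undefined\<close> outside
  \<^term>\<open>M\<close>.\<close>

definition Lip_loc :: "'a set \<Rightarrow> ('a, 'n::finite) chart set \<Rightarrow> ('a \<Rightarrow> real) set" where
  "Lip_loc M A = {f \<in> extensional M. \<forall>p\<in>M. \<exists>(U, \<phi>)\<in>charts_at A p. Lloc0 U (f \<circ> \<phi>) < \<infinity>}"

definition Lip_pt :: "'a set \<Rightarrow> ('a, 'n::finite) chart set \<Rightarrow> ('a \<Rightarrow> real) set" where
  "Lip_pt M A = {f \<in> extensional M. \<forall>p\<in>M. \<exists>(U, \<phi>)\<in>charts_at A p. Lpt0 U (f \<circ> \<phi>) < \<infinity>}"

definition bijective_linear ::
  "'a set \<Rightarrow> 'b set \<Rightarrow> ('a \<Rightarrow> real) set \<Rightarrow> ('b \<Rightarrow> real) set \<Rightarrow> (('a \<Rightarrow> real) \<Rightarrow> 'b \<Rightarrow> real) \<Rightarrow> bool" where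
  "bijective_linear M N E F T \<longleftrightarrow>
     bij_betw T E F \<and>
     (\<forall>f\<in>E. \<forall>g\<in>E. T (\<lambda>x\<in>M. f x + g x) = (\<lambda>x\<in>N. T f x + T g x)) \<and>
     (\<forall>c. \<forall>f\<in>E. T (\<lambda>x\<in>M. c * f x) = (\<lambda>x\<in>N. c * T f x))"

definition composition_operator :: "'b set \<Rightarrow> ('b \<Rightarrow> 'a) \<Rightarrow> ('a \<Rightarrow> real) \<Rightarrow> 'b \<Rightarrow> real" where
  "composition_operator N \<sigma> f = restrict (f \<circ> \<sigma>) N"


section \<open>Isometries\<close>

definition isometry :: "'a::metric_space set \<Rightarrow> 'b::metric_space set \<Rightarrow> ('a \<Rightarrow> 'b) \<Rightarrow> bool" where
  "isometry V U h \<longleftrightarrow> h \<in> V \<rightarrow> U \<and> (\<forall>x\<in>V. \<forall>y\<in>V. dist (h x) (h y) = dist x y)"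

definition flat_local_isometry ::
  "'b set \<Rightarrow> ('b, 'n::finite) chart set \<Rightarrow> ('a, 'n) chart set \<Rightarrow> ('b \<Rightarrow> 'a) \<Rightarrow> bool" where
  "flat_local_isometry N B A \<sigma> \<longleftrightarrow>
     (\<forall>p\<in>N. \<forall>(U, \<phi>)\<in>charts_at A (\<sigma> p). \<forall>(V, \<psi>)\<in>charts_at B p.
        \<sigma> ` \<psi> ` V \<subseteq> \<phi> ` U \<longrightarrow> isometry V U (inv_into U \<phi> \<circ> \<sigma> \<circ> \<psi>))"

end

theory Submission
  imports Defs
begin

text \<open>
  In charts, \<open>\<sigma>\<close> becomes a map \<open>h : V \<rightarrow> U\<close>. Composing with the bump function
  \<open>max 0 (r - |z - h x|)\<close>, whose constant at the centre is at most 1, gives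
  \<open>|h y - h x| \<le> (1 + o(1)) |y - x|\<close>. Since \<open>T\<close> is surjective, the bump function
  \<open>max 0 (r - |y - x|)\<close> on \<open>N\<close> has the form \<open>f \<circ> \<sigma>\<close>, so \<open>h\<close> is injective and
  \<open>|y - x| \<le> (1 + o(1)) |h y - h x|\<close>. By invariance of domain \<open>h\<close> is a homeomorphism onto an
  open set, and on small balls \<open>h\<close> and its inverse have pointwise dilation at most 1, hence are
  1-Lipschitz. So \<open>h\<close> is locally the restriction of a rigid motion, and this motion is the same
  everywhere because \<open>V\<close> is connected.
\<close>

section \<open>Infinitesimal isometries of Euclidean space\<close>

text \<open>For real-valued \<open>L\<close> this says that the limsup of
  \<open>dist (f y) (f x) / dist y x\<close> as \<open>y\<close> tends to \<open>x\<close> in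
  \<open>S\<close> is at most \<open>L\<close>. Multiplying out allows \<open>y = x\<close>, and
  ranging over \<open>K > L\<close> replaces the limsup.\<close>

definition dilation_le_at :: "'a::metric_space set \<Rightarrow> ('a \<Rightarrow> 'b::metric_space) \<Rightarrow> 'a \<Rightarrow> real \<Rightarrow> bool" where
  "dilation_le_at S f x L \<longleftrightarrow>
     (\<forall>K>L. \<exists>r>0. \<forall>y\<in>S. dist y x < r \<longrightarrow> dist (f y) (f x) \<le> K * dist y x)"

text \<open>Fix \<open>K > L\<close> and walk along the segment from \<open>x\<close> to
  \<open>y\<close>. The bound by \<open>K\<close> times the length passes from two adjacent
  subintervals to their union by the triangle inequality, and it holds on short intervals around
  each point. Bisection then gives it on the whole segment, and \<open>K\<close> decreases to
  \<open>L\<close>.\<close>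

lemma dilation_le_at_imp_lipschitz:
  fixes f :: "'a::real_normed_vector \<Rightarrow> 'b::metric_space"
  assumes S: "convex S" and f: "\<And>x. x \<in> S \<Longrightarrow> dilation_le_at S f x L"
    and x: "x \<in> S" and y: "y \<in> S"
  shows "dist (f x) (f y) \<le> L * dist x y"
proof (cases "x = y")
  case False
  then have pos: "dist x y > 0" by simp
  have "dist (f x) (f y) \<le> K * dist x y" if K: "K > L" for K
  proof -
    \<comment> \<open>Clamping the parameter keeps \<open>p t\<close> in \<open>S\<close> for every
      real \<open>t\<close>.\<close>
    define p where "p t = (if t < 0 then x else if t > 1 then y else x + t *\<^sub>R (y - x))" for t :: real
    have pS: "p t \<in> S" for t
      using S x y convexD_alt[of S x y t] by (auto simp: p_def algebra_simps)
    have pd: "dist (p s) (p t) = \<bar>s - t\<bar> * dist x y" if "s \<in> {0..1}" "t \<in> {0..1}" for s t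
    proof -
      have "p s - p t = (s - t) *\<^sub>R (y - x)"
        using that by (simp add: p_def scaleR_left_diff_distrib)
      then show ?thesis by (simp add: dist_norm norm_minus_commute)
    qed
    \<comment> \<open>The guards are there because \<open>Bolzano\<close> also tests intervals that
      stick out of the unit interval.\<close>
    define P where "P a b \<longleftrightarrow> (0 \<le> a \<longrightarrow> b \<le> 1 \<longrightarrow> dist (f (p a)) (f (p b)) \<le> K * ((b - a) * dist x y))"
      for a b
    have "(0::real) \<le> 1" by simp
    then have "P 0 1"
    proof (rule Bolzano)
      fix a b c assume trans: "P a b" "P b c" "a \<le> b" "b \<le> c"
      show "P a c"
        unfolding P_def
      proof (intro impI)
        assume "0 \<le> a" "c \<le> 1"
        then have "dist (f (p a)) (f (p b)) \<le> K * ((b - a) * dist x y)"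
          and "dist (f (p b)) (f (p c)) \<le> K * ((c - b) * dist x y)"
          using trans by (auto simp: P_def)
        moreover have "K * ((b - a) * dist x y) + K * ((c - b) * dist x y) = K * ((c - a) * dist x y)"
          by (simp add: algebra_simps)
        ultimately show "dist (f (p a)) (f (p c)) \<le> K * ((c - a) * dist x y)"
          using dist_triangle[of "f (p a)" "f (p c)" "f (p b)"] by linarith
      qed
    next
      fix t :: real assume t: "0 \<le> t" "t \<le> 1"
      obtain r where r: "r > 0" "\<And>z. z \<in> S \<Longrightarrow> dist z (p t) < r \<Longrightarrow> dist (f z) (f (p t)) \<le> K * dist z (p t)"
        using f[OF pS[of t]] K unfolding dilation_le_at_def by blast
      \<comment> \<open>The dilation bound only compares points with \<open>p t\<close>, so an
        interval around \<open>t\<close> is split at \<open>t\<close>. The length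
        \<open>r / dist x y\<close> puts both ends within \<open>r\<close> of
        \<open>p t\<close>.\<close>
      show "\<exists>d>0. \<forall>a b. a \<le> t \<and> t \<le> b \<and> b - a < d \<longrightarrow> P a b"
        unfolding P_def
      proof (intro exI[of _ "r / dist x y"] conjI allI impI)
        show "r / dist x y > 0" using r pos by simp
        fix a b
        assume ab: "a \<le> t \<and> t \<le> b \<and> b - a < r / dist x y" and "0 \<le> a" "b \<le> 1"
        then have "(b - a) * dist x y < r" using pos by (simp add: pos_less_divide_eq)
        have da: "dist (p a) (p t) = (t - a) * dist x y"
          and db: "dist (p b) (p t) = (b - t) * dist x y"
          using ab \<open>0 \<le> a\<close> \<open>b \<le> 1\<close> t by (simp_all add: pd)
        have "(t - a) * dist x y \<le> (b - a) * dist x y" "(b - t) * dist x y \<le> (b - a) * dist x y"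
          using ab by (intro mult_right_mono; simp)+
        then have "dist (p a) (p t) < r" "dist (p b) (p t) < r"
          using da db \<open>(b - a) * dist x y < r\<close> by linarith+
        then have "dist (f (p a)) (f (p t)) \<le> K * ((t - a) * dist x y)"
          and "dist (f (p b)) (f (p t)) \<le> K * ((b - t) * dist x y)"
          using r(2)[OF pS[of a]] r(2)[OF pS[of b]] da db by simp_all
        moreover have "K * ((t - a) * dist x y) + K * ((b - t) * dist x y) = K * ((b - a) * dist x y)"
          by (simp add: algebra_simps)
        ultimately show "dist (f (p a)) (f (p b)) \<le> K * ((b - a) * dist x y)"
          using dist_triangle2[of "f (p a)" "f (p b)" "f (p t)"] by linarith
      qed
    qed
    then show ?thesis by (simp add: p_def P_def)
  qed
  then have "dist (f x) (f y) / dist x y \<le> K" if "K > L" for K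
    using that pos by (simp add: pos_divide_le_eq)
  then have "dist (f x) (f y) / dist x y \<le> L" by (rule dense_ge)
  then show ?thesis using pos by (simp add: pos_divide_le_eq)
qed simp

text \<open>Fixing 0 and preserving distances preserves norms, hence inner products by polarization.
  The images of an orthogonal frame inside the ball then define an orthogonal map, which has the
  same inner products with \<open>f v\<close> as with its own values.\<close>

lemma ball_isometry_orthogonal:
  fixes f :: "'a::euclidean_space \<Rightarrow> 'a"
  assumes s: "s > 0" and f0: "f 0 = 0"
    and f: "\<And>x y. x \<in> ball 0 s \<Longrightarrow> y \<in> ball 0 s \<Longrightarrow> dist (f x) (f y) = dist x y"
  obtains G where "orthogonal_transformation G" "\<And>x. x \<in> ball 0 s \<Longrightarrow> f x = G x"
proof -
  have nf: "norm (f x) = norm x" if "x \<in> ball 0 s" for x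
    using f[of x 0] that s f0 by (simp add: dist_norm)
  have inn: "f x \<bullet> f y = x \<bullet> y" if "x \<in> ball 0 s" "y \<in> ball 0 s" for x y
    using f[OF that] nf that by (simp add: dot_norm_neg dist_norm)
  \<comment> \<open>Basis vectors may lie outside the ball. They are shrunk into it by
    \<open>t\<close>, and \<open>w\<close> undoes the scaling.\<close>
  define t where "t = s / 2"
  have t: "t > 0" "t < s" using s by (auto simp: t_def)
  define w where "w i = f (t *\<^sub>R i) /\<^sub>R t" for i
  have tb: "t *\<^sub>R i \<in> ball 0 s" if "i \<in> Basis" for i using t that by simp
  have fw: "f v \<bullet> w i = v \<bullet> i" if "v \<in> ball 0 s" "i \<in> Basis" for v i
    using inn[OF that(1) tb[OF that(2)]] t by (simp add: w_def)
  have ww: "w i \<bullet> w j = i \<bullet> j" if "i \<in> Basis" "j \<in> Basis" for i j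
    using fw[OF tb[OF that(1)] that(2)] t by (simp add: w_def)
  define G where "G v = (\<Sum>i\<in>Basis. (v \<bullet> i) *\<^sub>R w i)" for v
  have Gw: "G v \<bullet> w j = v \<bullet> j" if "j \<in> Basis" for v j
  proof -
    have "G v \<bullet> w j = (\<Sum>i\<in>Basis. (v \<bullet> i) * (i \<bullet> j))"
      unfolding G_def inner_sum_left using that by (intro sum.cong) (auto simp: ww)
    also have "\<dots> = v \<bullet> j"
      using that by (simp add: inner_Basis if_distrib cong: if_cong)
    finally show ?thesis .
  qed
  have GG: "G v \<bullet> G u = v \<bullet> u" for v u
  proof -
    have "G v \<bullet> G u = (\<Sum>i\<in>Basis. (u \<bullet> i) * (G v \<bullet> w i))"
      by (subst (2) G_def) (simp add: inner_sum_right)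
    then show ?thesis by (simp add: Gw euclidean_inner[of v u] mult.commute)
  qed
  have fG: "f v \<bullet> G u = v \<bullet> u" if "v \<in> ball 0 s" for v u
  proof -
    have "f v \<bullet> G u = (\<Sum>i\<in>Basis. (u \<bullet> i) * (f v \<bullet> w i))"
      unfolding G_def by (simp add: inner_sum_right)
    then show ?thesis using that by (simp add: fw euclidean_inner[of v u] mult.commute)
  qed
  have "linear G"
    by (rule linearI) (simp_all add: G_def inner_add_left scaleR_left_distrib sum.distrib scaleR_sum_right)
  show thesis
  proof
    show "orthogonal_transformation G"
      using \<open>linear G\<close> GG by (simp add: orthogonal_transformation_def)
    show "f x = G x" if "x \<in> ball 0 s" for x
    proof -
      \<comment> \<open>Each of the four inner products in the expansion equals
        \<open>x \<bullet> x\<close>, and they cancel.\<close>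
      have "(f x - G x) \<bullet> (f x - G x) = 0"
        using that by (simp add: inner_diff inner_commute[of "G x" "f x"] fG GG inn)
      then show ?thesis by simp
    qed
  qed
qed

text \<open>Near each point \<open>h\<close> is affine with orthogonal linear part, so its
  derivative is locally constant and therefore constant on the connected set. Subtracting this one
  linear map leaves a function with zero derivative, so \<open>h\<close> is the restriction of a
  single rigid motion.\<close>

lemma local_isometry_connected:
  fixes h :: "'a::euclidean_space \<Rightarrow> 'a"
  assumes V: "open V" "connected V"
    and loc: "\<And>x. x \<in> V \<Longrightarrow> \<exists>s>0. \<forall>y\<in>ball x s. \<forall>z\<in>ball x s. dist (h y) (h z) = dist y z"
    and x: "x \<in> V" and y: "y \<in> V"
  shows "dist (h x) (h y) = dist x y"
proof -
  \<comment> \<open>The same \<open>G\<close> must serve at all points of the ball, since local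
    constancy of the derivative is read off from this.\<close>
  have D: "\<exists>s>0. \<exists>G. orthogonal_transformation G \<and> (\<forall>y\<in>ball a s. (h has_derivative G) (at y))"
    if a: "a \<in> V" for a
  proof -
    obtain s where s: "s > 0" "\<forall>y\<in>ball a s. \<forall>z\<in>ball a s. dist (h y) (h z) = dist y z"
      using loc[OF a] by blast
    define f where "f v = h (a + v) - h a" for v
    have "dist (f u) (f v) = dist u v" if "u \<in> ball 0 s" "v \<in> ball 0 s" for u v
    proof -
      have "a + u \<in> ball a s" "a + v \<in> ball a s" using that by (auto simp: dist_norm)
      then have "dist (h (a + u)) (h (a + v)) = dist (a + u) (a + v)" using s by blast
      then show ?thesis by (simp add: f_def dist_norm)
    qed
    then obtain G where G: "orthogonal_transformation G" "\<And>v. v \<in> ball 0 s \<Longrightarrow> f v = G v"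
      using ball_isometry_orthogonal[OF s(1), of f] by (auto simp: f_def)
    have "bounded_linear G"
      using G(1) orthogonal_transformation_linear linear_linear by blast
    have eq: "h a + G (y - a) = h y" if "y \<in> ball a s" for y
    proof -
      have "h y - h a = G (y - a)"
        using G(2)[of "y - a"] that by (simp add: f_def dist_norm norm_minus_commute)
      then have "h y = G (y - a) + h a" by (simp only: diff_eq_eq)
      then show ?thesis by (simp only: add.commute)
    qed
    have "(h has_derivative G) (at y)" if "y \<in> ball a s" for y
    proof (rule has_derivative_transform_within_open[OF _ open_ball that])
      show "((\<lambda>y. h a + G (y - a)) has_derivative G) (at y)"
        by (auto intro!: derivative_eq_intros bounded_linear.has_derivative[OF \<open>bounded_linear G\<close>])
    qed (fact eq)
    then show ?thesis using s G by blast
  qed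
  \<comment> \<open>The derivative becomes a function of the point; its uniqueness identifies it
    with each local \<open>G\<close>.\<close>
  define F where "F z = frechet_derivative h (at z)" for z
  have "F constant_on V"
  proof (rule locally_constant_imp_constant[OF V(2)])
    fix a assume a: "a \<in> V"
    obtain s G where s: "s > 0" "\<forall>y\<in>ball a s. (h has_derivative G) (at y)" using D[OF a] by blast
    then have "F y = G" if "y \<in> ball a s" for y
      using that frechet_derivative_at[of h G y] by (simp add: F_def)
    then show "\<exists>T. openin (top_of_set V) T \<and> a \<in> T \<and> (\<forall>x\<in>T. F x = F a)"
      using a s(1) by (intro exI[of _ "V \<inter> ball a s"] conjI openin_open_Int open_ball) simp_all
  qed
  then obtain G where FG: "\<And>z. z \<in> V \<Longrightarrow> F z = G" by (auto simp: constant_on_def)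
  have hG: "(h has_derivative G) (at z)" and oG: "orthogonal_transformation G" if z: "z \<in> V" for z
  proof -
    obtain G' where "orthogonal_transformation G'" "(h has_derivative G') (at z)"
      using D[OF z] by (metis centre_in_ball)
    moreover from this have "G' = G" using FG[OF z] frechet_derivative_at[of h G' z] by (simp add: F_def)
    ultimately show "(h has_derivative G) (at z)" "orthogonal_transformation G" by auto
  qed
  have G: "orthogonal_transformation G" by (rule oG[OF x])
  then have "bounded_linear G"
    using orthogonal_transformation_linear linear_linear by blast
  have "h x - G x = h y - G y"
  proof (rule has_derivative_zero_unique_connected[OF V _ x y])
    show "((\<lambda>z. h z - G z) has_derivative (\<lambda>z. 0)) (at z)" if "z \<in> V" for z
      using hG[OF that] bounded_linear.has_derivative[OF \<open>bounded_linear G\<close> has_derivative_ident, of "at z"]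
      by (auto intro!: derivative_eq_intros)
  qed
  then have "h x - h y = G x - G y" by (simp add: algebra_simps)
  then have "h x - h y = G (x - y)"
    using linear_diff[OF orthogonal_transformation_linear[OF G], of x y] by simp
  then show ?thesis using G by (simp add: dist_norm orthogonal_transformation_norm)
qed

text \<open>The lower bound on \<open>h\<close> is an upper dilation bound for the inverse. Both
  maps are then 1-Lipschitz on small balls, which makes \<open>h\<close> a local isometry, and
  connectedness does the rest.\<close>

lemma infinitesimal_isometry_imp_isometry:
  fixes h :: "'a::euclidean_space \<Rightarrow> 'a"
  assumes V: "open V" "connected V" and inj: "inj_on h V"
    and upper: "\<And>x. x \<in> V \<Longrightarrow> dilation_le_at V h x 1"
    and lower: "\<And>x K. x \<in> V \<Longrightarrow> K > 1 \<Longrightarrow>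
      \<exists>r>0. \<forall>y\<in>V. dist y x < r \<longrightarrow> dist y x \<le> K * dist (h y) (h x)"
    and x: "x \<in> V" and y: "y \<in> V"
  shows "dist (h x) (h y) = dist x y"
proof (rule local_isometry_connected[OF V _ x y])
  fix x assume x: "x \<in> V"
  have conth: "continuous_on V h"
    unfolding continuous_on_iff
  proof (intro ballI allI impI)
    fix a and e :: real assume a: "a \<in> V" and e: "e > 0"
    obtain r where r: "r > 0" "\<forall>y\<in>V. dist y a < r \<longrightarrow> dist (h y) (h a) \<le> 2 * dist y a"
      using upper[OF a, unfolded dilation_le_at_def, rule_format, of 2] by auto
    show "\<exists>d>0. \<forall>y\<in>V. dist y a < d \<longrightarrow> dist (h y) (h a) < e"
    proof (intro exI[of _ "min r (e / 2)"] conjI ballI impI)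
      fix y assume "y \<in> V" "dist y a < min r (e / 2)"
      then have "dist (h y) (h a) \<le> 2 * dist y a" "dist y a < e / 2" using r by auto
      then show "dist (h y) (h a) < e" by linarith
    qed (use r e in simp)
  qed
  define k where "k = inv_into V h"
  have kh: "k (h z) = z" if "z \<in> V" for z using inj that by (simp add: k_def)
  \<comment> \<open>Invariance of domain applies because source and target are the same Euclidean
    space. It provides balls in the image, the convex sets on which the inverse can be
    treated.\<close>
  have op: "open (h ` V)" using invariance_of_domain[OF conth V(1) inj] .
  have contk: "continuous_on (h ` V) k"
    using continuous_on_inverse_open[OF V(1) conth _ kh] by simp
  \<comment> \<open>The lower bound concerns points near \<open>a\<close> in the source. Continuity
    of \<open>k\<close> converts closeness of the images into closeness of the preimages.\<close>
  have dk: "dilation_le_at (h ` V) k w 1" if w: "w \<in> h ` V" for w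
    unfolding dilation_le_at_def
  proof (intro allI impI)
    fix K :: real assume K: "K > 1"
    obtain a where a: "a \<in> V" "w = h a" using w by blast
    obtain r where r: "r > 0" "\<forall>y\<in>V. dist y a < r \<longrightarrow> dist y a \<le> K * dist (h y) (h a)"
      using lower[OF a(1) K] by blast
    obtain d where d: "d > 0" "\<forall>z\<in>h ` V. dist z w < d \<longrightarrow> dist (k z) (k w) < r"
      using contk w r(1) unfolding continuous_on_iff by blast
    show "\<exists>r>0. \<forall>z\<in>h ` V. dist z w < r \<longrightarrow> dist (k z) (k w) \<le> K * dist z w"
    proof (intro exI[of _ d] conjI ballI impI)
      fix z assume z: "z \<in> h ` V" "dist z w < d"
      then obtain y where y: "y \<in> V" "z = h y" by blast
      then have "dist y a < r" using d z kh a by auto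
      then show "dist (k z) (k w) \<le> K * dist z w" using r y a kh by simp
    qed (fact d(1))
  qed
  \<comment> \<open>The radii are chosen so that the ball about \<open>x\<close> lies in
    \<open>V\<close> and is mapped into a ball inside the image; both balls are convex.\<close>
  obtain t where t: "t > 0" "ball (h x) t \<subseteq> h ` V"
    using op x open_contains_ball by blast
  obtain s1 where s1: "s1 > 0" "ball x s1 \<subseteq> V" using V x open_contains_ball by blast
  obtain s2 where s2: "s2 > 0" "\<forall>y\<in>V. dist y x < s2 \<longrightarrow> dist (h y) (h x) < t"
    using conth x t unfolding continuous_on_iff by blast
  define s where "s = min s1 s2"
  have sV: "ball x s \<subseteq> V" using s1 by (auto simp: s_def)
  show "\<exists>s>0. \<forall>y\<in>ball x s. \<forall>z\<in>ball x s. dist (h y) (h z) = dist y z"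
  proof (intro exI[of _ s] conjI ballI)
    show "s > 0" using s1 s2 by (simp add: s_def)
    fix y z assume yz: "y \<in> ball x s" "z \<in> ball x s"
    have le: "dist (h y) (h z) \<le> 1 * dist y z"
    proof (rule dilation_le_at_imp_lipschitz[OF convex_ball _ yz])
      show "dilation_le_at (ball x s) h a 1" if "a \<in> ball x s" for a
        using upper[of a] that sV unfolding dilation_le_at_def by blast
    qed
    have inV: "y \<in> V" "z \<in> V" using yz sV by auto
    have hyz: "h y \<in> ball (h x) t" "h z \<in> ball (h x) t"
      using s2(2)[rule_format, OF inV(1)] s2(2)[rule_format, OF inV(2)] yz
      by (auto simp: s_def dist_commute[of _ x] dist_commute[of _ "h x"])
    have "dist (k (h y)) (k (h z)) \<le> 1 * dist (h y) (h z)"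
    proof (rule dilation_le_at_imp_lipschitz[OF convex_ball _ hyz])
      show "dilation_le_at (ball (h x) t) k a 1" if "a \<in> ball (h x) t" for a
        using dk[of a] that t unfolding dilation_le_at_def by blast
    qed
    then show "dist (h y) (h z) = dist y z" using le unfolding kh[OF inV(1)] kh[OF inV(2)] by linarith
  qed
qed

section \<open>Recentred charts\<close>

lemma has_derivative_shift_iff:
  "((\<lambda>x. f (x + a)) has_derivative D) (at x) \<longleftrightarrow> (f has_derivative D) (at (x + a))"
proof
  have sh: "((\<lambda>x. x + c) has_derivative (\<lambda>x. x)) (at y)" for c y :: 'a
    by (auto intro!: derivative_eq_intros)
  show "((\<lambda>x. f (x + a)) has_derivative D) (at x)" if "(f has_derivative D) (at (x + a))"
    using has_derivative_compose[OF sh that] by simp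
  show "(f has_derivative D) (at (x + a))" if "((\<lambda>x. f (x + a)) has_derivative D) (at x)"
    using has_derivative_compose[OF sh[of "- a" "x + a"], of "\<lambda>x. f (x + a)" D] that by simp
qed

text \<open>True even where no derivative exists: \<open>frechet_derivative\<close> is a choice from
  a predicate, and the two predicates coincide.\<close>

lemma frechet_derivative_shift:
  "frechet_derivative (\<lambda>x. f (x + a)) (at x) = frechet_derivative f (at (x + a))"
  by (simp add: frechet_derivative_def has_derivative_shift_iff)

lemma has_derivative_minus_const_iff:
  "((\<lambda>x. f x - c) has_derivative D) F \<longleftrightarrow> (f has_derivative D) F"
proof
  show "((\<lambda>x. f x - c) has_derivative D) F" if "(f has_derivative D) F"
    using that by (auto intro!: derivative_eq_intros)
  show "(f has_derivative D) F" if "((\<lambda>x. f x - c) has_derivative D) F"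
    using has_derivative_add[OF that has_derivative_const[of c]] by simp
qed

lemma frechet_derivative_minus_const:
  "frechet_derivative (\<lambda>x. f x - c) F = frechet_derivative f F"
  by (simp add: frechet_derivative_def has_derivative_minus_const_iff)

lemma has_derivative_cong_open:
  assumes "open S" "x \<in> S" "\<And>y. y \<in> S \<Longrightarrow> f y = g y"
  shows "(f has_derivative D) (at x) \<longleftrightarrow> (g has_derivative D) (at x)"
  using has_derivative_transform_within_open[OF _ assms(1,2)] assms(3) by metis

lemma frechet_derivative_cong_open:
  assumes "open S" "x \<in> S" "\<And>y. y \<in> S \<Longrightarrow> f y = g y"
  shows "frechet_derivative f (at x) = frechet_derivative g (at x)"
  using has_derivative_cong_open[OF assms] by (simp add: frechet_derivative_def)

text \<open>Derivatives are taken in the full space, so agreement on \<open>S\<close> passes to them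
  because \<open>S\<close> is open. Both functions are generalized since the induction hypothesis is
  applied to their directional derivatives.\<close>

lemma Ck_on_cong:
  assumes "open S" "\<And>x. x \<in> S \<Longrightarrow> f x = g x" "Ck_on k S f"
  shows "Ck_on k S g"
  using assms(2,3)
proof (induction k arbitrary: f g)
  case 0
  then show ?case by (auto cong: continuous_on_cong)
next
  case (Suc k)
  have "g differentiable (at x)" if "x \<in> S" for x
  proof -
    have "f differentiable (at x)" using Suc.prems(2) that by simp
    then show ?thesis
      using has_derivative_cong_open[OF assms(1) that, of f g] Suc.prems(1)
      unfolding differentiable_def by blast
  qed
  moreover have "Ck_on k S (\<lambda>x. frechet_derivative g (at x) v)" for v
    using Suc.IH[of "\<lambda>x. frechet_derivative f (at x) v" "\<lambda>x. frechet_derivative g (at x) v"]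
      frechet_derivative_cong_open[OF assms(1) _ Suc.prems(1)] Suc.prems(2) by simp
  ultimately show ?case by simp
qed

lemma Ck_on_shift:
  "Ck_on k S f \<Longrightarrow> Ck_on k {x. x + a \<in> S} (\<lambda>x. f (x + a))"
proof (induction k arbitrary: f)
  case 0
  then show ?case
    by (auto intro!: continuous_on_compose2[of S f] continuous_intros)
next
  case (Suc k)
  have "(\<lambda>x. f (x + a)) differentiable (at x)" if "x + a \<in> S" for x
    using Suc.prems that by (auto simp: differentiable_def has_derivative_shift_iff)
  then show ?case
    using Suc.IH[of "\<lambda>x. frechet_derivative f (at x) v" for v] Suc.prems
    by (simp add: frechet_derivative_shift)
qed

text \<open>A case split suffices, as the constant disappears after one differentiation.\<close>

lemma Ck_on_minus_const: "Ck_on k S f \<Longrightarrow> Ck_on k S (\<lambda>x. f x - c)"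
  by (cases k)
    (auto intro!: continuous_intros
      simp: frechet_derivative_minus_const differentiable_def has_derivative_minus_const_iff)

lemma open_shift: "open S \<Longrightarrow> open {x. x + (a::'a::real_normed_vector) \<in> S}"
proof -
  assume "open S"
  then have "open ((\<lambda>x. x + a) -` S)"
    by (intro open_vimage continuous_intros)
  then show ?thesis by (simp add: vimage_def)
qed

lemma bij_betw_shift: "bij_betw (\<lambda>x. x + a) {x. x + (a::'a::group_add) \<in> S} S"
  by (rule bij_betwI[where g="\<lambda>x. x - a"]) auto

lemma diffeomorphism_cong:
  assumes "diffeomorphism S T f" "\<And>x. x \<in> S \<Longrightarrow> f x = g x"
  shows "diffeomorphism S T g"
proof -
  have b: "bij_betw f S T" and b': "bij_betw g S T"
    using assms bij_betw_cong[of S f g T] by (auto simp: diffeomorphism_def)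
  have "inv_into S f y = inv_into S g y" if "y \<in> T" for y
    using that b b' assms(2) by (metis bij_betw_imp_surj_on bij_betw_inv_into_left f_inv_into_f inv_into_into)
  then show ?thesis
    using assms b' Ck_on_cong[of S f g] Ck_on_cong[of T "inv_into S f" "inv_into S g"]
    by (auto simp: diffeomorphism_def smooth_on_def)
qed

text \<open>Translating the source subtracts a constant from the inverse. For a translated target
  the two roles are exchanged.\<close>

lemma diffeomorphism_shift_source:
  assumes "diffeomorphism S T f"
  shows "diffeomorphism {x. x + a \<in> S} T (\<lambda>x. f (x + a))"
proof -
  have b: "bij_betw f S T" using assms by (simp add: diffeomorphism_def)
  have b': "bij_betw (\<lambda>x. f (x + a)) {x. x + a \<in> S} T"
    using bij_betw_trans[OF bij_betw_shift b] by (simp add: comp_def)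
  have inv: "inv_into S f y - a = inv_into {x. x + a \<in> S} (\<lambda>x. f (x + a)) y" if "y \<in> T" for y
  proof -
    have *: "inv_into S f y \<in> S" "f (inv_into S f y) = y"
      using that b by (auto simp: bij_betw_def f_inv_into_f inv_into_into)
    show ?thesis
      by (rule inv_into_f_eq[symmetric, OF bij_betw_imp_inj_on[OF b']]) (use * in auto)
  qed
  have "Ck_on k T (inv_into {x. x + a \<in> S} (\<lambda>x. f (x + a)))" for k
    using assms by (intro Ck_on_cong[OF _ inv Ck_on_minus_const]) (auto simp: diffeomorphism_def smooth_on_def)
  then show ?thesis
    using assms b' open_shift[of S a] Ck_on_shift[of _ S f a]
    by (simp add: diffeomorphism_def smooth_on_def)
qed

lemma diffeomorphism_shift_target:
  assumes "diffeomorphism S T f"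
  shows "diffeomorphism S {y. y + a \<in> T} (\<lambda>x. f x - a)"
proof -
  have b: "bij_betw f S T" using assms by (simp add: diffeomorphism_def)
  have b': "bij_betw (\<lambda>x. f x - a) S {y. y + a \<in> T}"
    by (rule bij_betwI[where g="\<lambda>y. inv_into S f (y + a)"])
      (use b in \<open>auto simp: bij_betw_def inv_into_into f_inv_into_f\<close>)
  have inv: "inv_into S f (y + a) = inv_into S (\<lambda>x. f x - a) y" if "y + a \<in> T" for y
  proof -
    have *: "inv_into S f (y + a) \<in> S" "f (inv_into S f (y + a)) = y + a"
      using that b by (auto simp: bij_betw_def f_inv_into_f inv_into_into)
    show ?thesis
      by (rule inv_into_f_eq[symmetric, OF bij_betw_imp_inj_on[OF b']]) (use * in auto)
  qed
  have T: "open {y. y + a \<in> T}"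
    using assms by (simp add: diffeomorphism_def open_shift)
  have "Ck_on k {y. y + a \<in> T} (inv_into S (\<lambda>x. f x - a))" for k
  proof (rule Ck_on_cong[OF T])
    show "Ck_on k {y. y + a \<in> T} (\<lambda>y. inv_into S f (y + a))"
      using assms by (intro Ck_on_shift) (simp add: diffeomorphism_def smooth_on_def)
  qed (simp add: inv)
  then show ?thesis
    using assms b' T Ck_on_minus_const[of _ S f a]
    by (simp add: diffeomorphism_def smooth_on_def)
qed

section \<open>Translated charts and their compatibility\<close>

definition shift_chart :: "real ^ 'n \<Rightarrow> ('a, 'n::finite) chart \<Rightarrow> ('a, 'n) chart" where
  "shift_chart a = (\<lambda>(U, \<phi>). ({x. x + a \<in> U}, \<lambda>x. \<phi> (x + a)))"

lemma shift_chart_image: "(\<lambda>x. \<phi> (x + a)) ` {x. x + (a::'a::group_add) \<in> U} = \<phi> ` U"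
  using bij_betw_imp_surj_on[OF bij_betw_shift[of a U]] by (metis image_image)

lemma is_chart_shift:
  assumes "is_chart M (U, \<phi>)" "a \<in> U"
  shows "is_chart M (shift_chart a (U, \<phi>))"
proof -
  have "{x. x + a \<in> U} = (\<lambda>x. x - a) ` U"
    by (force simp: image_iff)
  moreover have "connected ((\<lambda>x. x - a) ` U)"
    using assms by (intro connected_continuous_image continuous_intros) (simp add: is_chart_def)
  ultimately show ?thesis
    using assms open_shift[of U a]
    by (auto simp: is_chart_def shift_chart_def PiE_iff extensional_def inj_on_def)
qed

lemma inv_into_shift:
  fixes \<phi> :: "'a::group_add \<Rightarrow> 'b"
  assumes "inj_on \<phi> U" "p \<in> \<phi> ` U"
  shows "inv_into {x. x + a \<in> U} (\<lambda>x. \<phi> (x + a)) p = inv_into U \<phi> p - a"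
proof (rule inv_into_f_eq)
  show "inj_on (\<lambda>x. \<phi> (x + a)) {x. x + a \<in> U}"
    using comp_inj_on_iff[of "\<lambda>x. x + a" "{x. x + a \<in> U}" \<phi>] assms(1)
      bij_betw_imp_surj_on[OF bij_betw_shift[of a U]] by (simp add: comp_def inj_on_def)
qed (use assms in \<open>auto simp: inv_into_into f_inv_into_f\<close>)

text \<open>The chart keeps its image, so the overlap \<open>W\<close> is unchanged. The transition
  map only loses the constant \<open>a\<close>, which does not affect its derivative.\<close>

lemma flat_compatible_shift_left:
  fixes a :: "real ^ 'n::finite"
  assumes "flat_compatible (U, \<phi>) (V, \<psi>)" "inj_on \<phi> U"
  shows "flat_compatible (shift_chart a (U, \<phi>)) (V, \<psi>)"
proof -
  define W where "W = \<phi> ` U \<inter> \<psi> ` V"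
  define \<tau> where "\<tau> x = inv_into U \<phi> (\<psi> x)" for x
  define \<tau>' where "\<tau>' x = inv_into {x. x + a \<in> U} (\<lambda>x. \<phi> (x + a)) (\<psi> x)" for x
  define S where "S = {x \<in> V. \<psi> x \<in> W}"
  show ?thesis
  proof (cases "W = {}")
    case True
    then show ?thesis
      by (simp add: flat_compatible_def shift_chart_def shift_chart_image W_def)
  next
    case False
    then have d: "diffeomorphism S {y \<in> U. \<phi> y \<in> W} \<tau>"
      and o: "\<And>x. x \<in> S \<Longrightarrow> orthogonal_matrix (jacobian \<tau> (at x))"
      using assms(1) by (auto simp: flat_compatible_def Let_def W_def S_def \<tau>_def[abs_def])
    have eq: "\<tau> x - a = \<tau>' x" if "x \<in> S" for x
      using that inv_into_shift[OF assms(2), of "\<psi> x" a] by (simp add: S_def W_def \<tau>_def \<tau>'_def)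
    have "diffeomorphism S {y. y + a \<in> {y \<in> U. \<phi> y \<in> W}} \<tau>'"
      using diffeomorphism_cong[OF diffeomorphism_shift_target[OF d] eq] .
    moreover have "orthogonal_matrix (jacobian \<tau>' (at x))" if "x \<in> S" for x
    proof -
      have "open S" using d by (simp add: diffeomorphism_def)
      then have "frechet_derivative \<tau>' (at x) = frechet_derivative \<tau> (at x)"
        using frechet_derivative_cong_open[OF \<open>open S\<close> that eq] by (simp add: frechet_derivative_minus_const)
      then show ?thesis using o[OF that] by (simp add: jacobian_def)
    qed
    ultimately show ?thesis
      unfolding flat_compatible_def shift_chart_def Let_def split_conv shift_chart_image
        W_def[symmetric] \<tau>'_def[symmetric] S_def by simp
  qed
qed

text \<open>Here the shifted chart is the source of the transition map, which is therefore
  precomposed with a translation.\<close>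

lemma flat_compatible_shift_right:
  fixes a :: "real ^ 'n::finite"
  assumes "flat_compatible (U, \<phi>) (V, \<psi>)"
  shows "flat_compatible (U, \<phi>) (shift_chart a (V, \<psi>))"
proof -
  define W where "W = \<phi> ` U \<inter> \<psi> ` V"
  define \<tau> where "\<tau> x = inv_into U \<phi> (\<psi> x)" for x
  define S where "S = {x \<in> V. \<psi> x \<in> W}"
  show ?thesis
  proof (cases "W = {}")
    case True
    then show ?thesis
      by (simp add: flat_compatible_def shift_chart_def shift_chart_image W_def)
  next
    case False
    then have d: "diffeomorphism S {y \<in> U. \<phi> y \<in> W} \<tau>"
      and o: "\<And>x. x \<in> S \<Longrightarrow> orthogonal_matrix (jacobian \<tau> (at x))"
      using assms(1) by (auto simp: flat_compatible_def Let_def W_def S_def \<tau>_def[abs_def])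
    have "diffeomorphism {x. x + a \<in> S} {y \<in> U. \<phi> y \<in> W} (\<lambda>x. \<tau> (x + a))"
      by (rule diffeomorphism_shift_source[OF d])
    moreover have "orthogonal_matrix (jacobian (\<lambda>x. \<tau> (x + a)) (at x))" if "x + a \<in> S" for x
      using o[OF that] by (simp add: jacobian_def frechet_derivative_shift)
    ultimately show ?thesis
      unfolding flat_compatible_def shift_chart_def Let_def split_conv shift_chart_image
        W_def[symmetric] S_def \<tau>_def by simp
  qed
qed

text \<open>By maximality, a chart can be recentred at any point of its domain.\<close>

lemma flat_atlas_shift:
  assumes A: "flat_atlas M A" and c: "(U, \<phi>) \<in> A" and a: "a \<in> U"
  shows "shift_chart a (U, \<phi>) \<in> A"
proof -
  let ?c = "shift_chart a (U, \<phi>)"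
  have pre: "flat_preatlas M A" using A by (simp add: flat_atlas_def)
  then have chart: "is_chart M d" if "d \<in> A" for d using that by (simp add: flat_preatlas_def)
  have comp: "flat_compatible d e" if "d \<in> A" "e \<in> A" for d e
    using pre that by (simp add: flat_preatlas_def)
  have inj: "inj_on \<phi> U" using chart[OF c] by (simp add: is_chart_def)
  have left: "flat_compatible ?c d" if "d \<in> A" for d
    using flat_compatible_shift_left[of U \<phi> "fst d" "snd d"] comp[OF c that] inj by simp
  have right: "flat_compatible d ?c" if "d \<in> A" for d
    using flat_compatible_shift_right[of "fst d" "snd d" U \<phi>] comp[OF that c] by simp
  \<comment> \<open>Start from \<open>left\<close> for the original chart and then shift the second
    chart too.\<close>
  have self: "flat_compatible ?c ?c"
    using flat_compatible_shift_right[of "fst ?c" "snd ?c" U \<phi> a] left[OF c] by simp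
  have "flat_preatlas M (insert ?c A)"
    using pre left right self is_chart_shift[OF chart[OF c] a]
    unfolding flat_preatlas_def by auto
  then have "insert ?c A = A" using A unfolding flat_atlas_def by blast
  then show ?thesis by blast
qed

section \<open>Lipschitz constants in charts\<close>

lemma Lpt0_le_iff:
  "Lpt0 U g \<le> ereal L \<longleftrightarrow>
     (\<forall>K>L. \<exists>r>0. \<forall>x\<in>U. norm x < r \<longrightarrow> \<bar>g x - g 0\<bar> \<le> K * norm x)"
proof
  assume le: "Lpt0 U g \<le> ereal L"
  show "\<forall>K>L. \<exists>r>0. \<forall>x\<in>U. norm x < r \<longrightarrow> \<bar>g x - g 0\<bar> \<le> K * norm x"
  proof (intro allI impI)
    fix K assume "K > L"
    then have "eventually (\<lambda>x. ereal (\<bar>g x - g 0\<bar> / norm x) < ereal K) (at 0 within U)"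
      using le[unfolded Lpt0_def Limsup_le_iff, rule_format, of "ereal K"] by simp
    then obtain r where r: "r > 0" "\<And>x. x \<in> U \<Longrightarrow> x \<noteq> 0 \<Longrightarrow> norm x < r \<Longrightarrow> \<bar>g x - g 0\<bar> / norm x < K"
      unfolding eventually_at by auto
    have "\<bar>g x - g 0\<bar> \<le> K * norm x" if "x \<in> U" "norm x < r" for x
      using r(2)[of x] that by (cases "x = 0") (auto simp: pos_divide_less_eq)
    then show "\<exists>r>0. \<forall>x\<in>U. norm x < r \<longrightarrow> \<bar>g x - g 0\<bar> \<le> K * norm x"
      using r(1) by blast
  qed
next
  assume le: "\<forall>K>L. \<exists>r>0. \<forall>x\<in>U. norm x < r \<longrightarrow> \<bar>g x - g 0\<bar> \<le> K * norm x"
  show "Lpt0 U g \<le> ereal L"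
    unfolding Lpt0_def Limsup_le_iff
  proof (intro allI impI)
    fix y assume "y > ereal L"
    then obtain K where K: "K > L" "ereal K < y" using ereal_dense2 by (metis less_ereal.simps(1))
    obtain r where r: "r > 0" "\<And>x. x \<in> U \<Longrightarrow> norm x < r \<Longrightarrow> \<bar>g x - g 0\<bar> \<le> K * norm x"
      using le K(1) by blast
    have "ereal (\<bar>g x - g 0\<bar> / norm x) < y" if "x \<in> U" "x \<noteq> 0" "norm x < r" for x
    proof -
      have "\<bar>g x - g 0\<bar> / norm x \<le> K" using r(2)[of x] that by (simp add: pos_divide_le_eq)
      then show ?thesis using K(2) by (meson ereal_less_eq(3) le_less_trans)
    qed
    then show "eventually (\<lambda>x. ereal (\<bar>g x - g 0\<bar> / norm x) < y) (at 0 within U)"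
      unfolding eventually_at using r(1) by auto
  qed
qed

text \<open>Used to show that the limit in \<open>Lloc0\<close> exists, so that \<open>Lim\<close>
  denotes it and equals an infimum.\<close>

lemma tendsto_at_right_INF:
  fixes h :: "real \<Rightarrow> ereal"
  assumes "\<And>x y. a < x \<Longrightarrow> x \<le> y \<Longrightarrow> h x \<le> h y"
  shows "(h \<longlongrightarrow> (INF x\<in>{a<..}. h x)) (at_right a)"
proof (rule order_tendstoI)
  fix b assume b: "b < (INF x\<in>{a<..}. h x)"
  have "b < h x" if "a < x" for x
    using b that by (meson INF_lower greaterThan_iff less_le_trans)
  then show "eventually (\<lambda>x. b < h x) (at_right a)"
    by (simp add: eventually_at_filter)
next
  fix b assume "(INF x\<in>{a<..}. h x) < b"
  then obtain y where y: "a < y" "h y < b" by (auto simp: INF_less_iff)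
  have "h x < b" if "a < x" "x < y" for x
    using assms[of x y] that y by (meson le_less_trans less_imp_le)
  then show "eventually (\<lambda>x. h x < b) (at_right a)"
    using y(1) unfolding eventually_at_right[OF y(1)] by blast
qed

text \<open>The suprema are monotone in the radius, so their limit at 0 is their infimum, and an
  infimum is at most \<open>L\<close> iff every \<open>K > L\<close> bounds some supremum.\<close>

lemma Lloc0_le_iff:
  "Lloc0 U g \<le> ereal L \<longleftrightarrow>
     (\<forall>K>L. \<exists>r>0. \<forall>x\<in>U. \<forall>y\<in>U. norm x < r \<longrightarrow> norm y < r \<longrightarrow> \<bar>g x - g y\<bar> \<le> K * norm (x - y))"
proof -
  define D where "D e = {(x, y). x \<in> ball 0 e \<inter> U \<and> y \<in> ball 0 e \<inter> U \<and> x \<noteq> y}" for e :: real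
  define h where "h e = (SUP (x, y) \<in> D e. ereal (\<bar>g x - g y\<bar> / norm (x - y)))" for e
  have mono: "h e \<le> h e'" if "e \<le> e'" for e e'
    unfolding h_def using that by (intro SUP_subset_mono) (auto simp: D_def)
  have "Lloc0 U g = Lim (at_right 0) h"
    by (simp add: Lloc0_def h_def[abs_def] D_def)
  also have "\<dots> = (INF e\<in>{0<..}. h e)"
    by (intro tendsto_Lim tendsto_at_right_INF mono) auto
  finally have L: "Lloc0 U g = (INF e\<in>{0<..}. h e)" .
  have h_le: "h r \<le> ereal K \<longleftrightarrow>
      (\<forall>x\<in>U. \<forall>y\<in>U. norm x < r \<longrightarrow> norm y < r \<longrightarrow> \<bar>g x - g y\<bar> \<le> K * norm (x - y))" for r K
    unfolding h_def SUP_le_iff D_def by (force simp: pos_divide_le_eq)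
  have "(INF e\<in>{0<..}. h e) \<le> ereal L \<longleftrightarrow> (\<forall>K>L. \<exists>r>0. h r \<le> ereal K)"
  proof
    assume "(INF e\<in>{0<..}. h e) \<le> ereal L"
    then show "\<forall>K>L. \<exists>r>0. h r \<le> ereal K"
      unfolding INF_le_iff by (metis greaterThan_iff less_ereal.simps(1) less_imp_le)
  next
    assume *: "\<forall>K>L. \<exists>r>0. h r \<le> ereal K"
    show "(INF e\<in>{0<..}. h e) \<le> ereal L"
      unfolding INF_le_iff
    proof (intro allI impI)
      fix y assume "y > ereal L"
      then obtain K where K: "K > L" "ereal K < y" using ereal_dense2 by (metis less_ereal.simps(1))
      then obtain r where "r > 0" "h r \<le> ereal K" using * by blast
      then show "\<exists>i\<in>{0<..}. h i < y" using K(2) by (meson greaterThan_iff le_less_trans)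
    qed
  qed
  then show ?thesis by (simp add: L h_le)
qed

lemma Lpt0_le_if_Lloc0_le:
  assumes "Lloc0 U g \<le> ereal L" "0 \<in> U"
  shows "Lpt0 U g \<le> ereal L"
  unfolding Lpt0_le_iff
proof (intro allI impI)
  fix K assume "K > L"
  then obtain r where "r > 0"
    "\<And>x y. x \<in> U \<Longrightarrow> y \<in> U \<Longrightarrow> norm x < r \<Longrightarrow> norm y < r \<Longrightarrow> \<bar>g x - g y\<bar> \<le> K * norm (x - y)"
    using assms(1) unfolding Lloc0_le_iff by blast
  then show "\<exists>r>0. \<forall>x\<in>U. norm x < r \<longrightarrow> \<bar>g x - g 0\<bar> \<le> K * norm x"
    using assms(2) by (metis diff_zero norm_zero)
qed

lemma
  assumes "flat_atlas M A" "c \<in> A"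
  shows flat_atlas_is_chart: "is_chart M c"
    and flat_atlas_compatible: "d \<in> A \<Longrightarrow> flat_compatible c d"
  using assms by (auto simp: flat_atlas_def flat_preatlas_def)

lemma shift_chart_in_charts_at:
  assumes "flat_atlas M A" "(U, \<phi>) \<in> A" "a \<in> U"
  shows "({x. x + a \<in> U}, \<lambda>x. \<phi> (x + a)) \<in> charts_at A (\<phi> a)"
  using flat_atlas_shift[OF assms] by (simp add: charts_at_def shift_chart_def)

text \<open>A covering chart through \<open>p\<close> is recentred there. This supplies the charts
  that membership in \<open>Lip_loc\<close> and \<open>Lip_pt\<close> asks for.\<close>

lemma charts_at_nonempty:
  assumes "flat_atlas M A" "p \<in> M"
  shows "charts_at A p \<noteq> {}"
proof -
  have "p \<in> (\<Union>(U, \<phi>)\<in>A. \<phi> ` U)"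
    using assms unfolding flat_atlas_def flat_preatlas_def by blast
  then obtain U \<phi> a where "(U, \<phi>) \<in> A" "a \<in> U" "p = \<phi> a" by auto
  then show ?thesis using shift_chart_in_charts_at[OF assms(1)] by blast
qed

section \<open>Independence of the chart\<close>

text \<open>An orthogonal derivative has operator norm at most 1, so the mean value inequality
  applies with constant 1. It needs a convex set, hence the restriction to a ball in the
  overlap.\<close>

lemma transition_lipschitz:
  fixes A :: "('a, 'n::finite) chart set"
  assumes A: "flat_atlas M A"
    and c: "(U, \<phi>) \<in> charts_at A p" and d: "(V, \<psi>) \<in> charts_at A p"
  obtains r \<tau> where "r > 0" "ball 0 r \<subseteq> V" "\<tau> 0 = 0"
    "\<And>x. x \<in> ball 0 r \<Longrightarrow> \<tau> x \<in> U \<and> \<phi> (\<tau> x) = \<psi> x"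
    "\<And>x y. x \<in> ball 0 r \<Longrightarrow> y \<in> ball 0 r \<Longrightarrow> norm (\<tau> x - \<tau> y) \<le> norm (x - y)"
proof -
  define W where "W = \<phi> ` U \<inter> \<psi> ` V"
  define \<tau> where "\<tau> x = inv_into U \<phi> (\<psi> x)" for x
  define S where "S = {x \<in> V. \<psi> x \<in> W}"
  have cd: "(U, \<phi>) \<in> A" "\<phi> 0 = p" "(V, \<psi>) \<in> A" "\<psi> 0 = p"
    using c d by (auto simp: charts_at_def)
  have U: "0 \<in> U" "inj_on \<phi> U" and V: "0 \<in> V"
    using flat_atlas_is_chart[OF A cd(1)] flat_atlas_is_chart[OF A cd(3)] by (auto simp: is_chart_def)
  have "p \<in> W" using cd U V by (force simp: W_def)
  then have df: "diffeomorphism S {y \<in> U. \<phi> y \<in> W} \<tau>"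
    and o: "\<And>x. x \<in> S \<Longrightarrow> orthogonal_matrix (jacobian \<tau> (at x))"
    using flat_atlas_compatible[OF A cd(1,3)]
    by (auto simp: flat_compatible_def Let_def W_def S_def \<tau>_def[abs_def])
  have "open S" "0 \<in> S" using df V \<open>p \<in> W\<close> cd by (auto simp: diffeomorphism_def S_def)
  then obtain r where r: "r > 0" "ball 0 r \<subseteq> S" using open_contains_ball by blast
  have der: "(\<tau> has_derivative frechet_derivative \<tau> (at x)) (at x)"
    and on: "onorm (frechet_derivative \<tau> (at x)) \<le> 1" if "x \<in> S" for x
  proof -
    have "Ck_on (Suc 0) S \<tau>" using df by (auto simp: diffeomorphism_def smooth_on_def)
    then have "\<tau> differentiable (at x)" using that by simp
    then show *: "(\<tau> has_derivative frechet_derivative \<tau> (at x)) (at x)"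
      using frechet_derivative_works by blast
    have "orthogonal_transformation (frechet_derivative \<tau> (at x))"
      using o[OF that] has_derivative_linear[OF *]
      by (simp add: orthogonal_transformation_matrix jacobian_def)
    then show "onorm (frechet_derivative \<tau> (at x)) \<le> 1"
      by (intro onorm_le) (simp add: orthogonal_transformation_norm)
  qed
  show thesis
  proof
    show "r > 0" "ball 0 r \<subseteq> V" using r by (auto simp: S_def)
    show "\<tau> 0 = 0" using U cd by (metis \<tau>_def inv_into_f_f)
    show "\<tau> x \<in> U \<and> \<phi> (\<tau> x) = \<psi> x" if "x \<in> ball 0 r" for x
      using that r by (auto simp: S_def W_def \<tau>_def inv_into_into f_inv_into_f)
    show "norm (\<tau> x - \<tau> y) \<le> norm (x - y)" if xy: "x \<in> ball 0 r" "y \<in> ball 0 r" for x y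
    proof -
      have "norm (\<tau> x - \<tau> y) \<le> 1 * norm (x - y)"
      proof (rule differentiable_bound[OF convex_ball _ _ xy])
        fix z :: "real ^ 'n" assume "z \<in> ball 0 r"
        then have z: "z \<in> S" using r(2) by blast
        show "(\<tau> has_derivative frechet_derivative \<tau> (at z)) (at z within ball 0 r)"
          using der[OF z] by (rule has_derivative_at_withinI)
        show "onorm (frechet_derivative \<tau> (at z)) \<le> 1" by (rule on[OF z])
      qed
      then show ?thesis by simp
    qed
  qed
qed

text \<open>Near 0 the second chart is the first one after a 1-Lipschitz map fixing 0. As
  \<open>L \<ge> 0\<close> makes \<open>K\<close> positive, the bound survives this substitution.
  Exchanging the charts gives the reverse comparison.\<close>

lemma Lpt0_le_change_chart:
  assumes A: "flat_atlas M A" and c: "(U, \<phi>) \<in> charts_at A p" and d: "(V, \<psi>) \<in> charts_at A p"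
    and L: "L \<ge> 0" and le: "Lpt0 U (f \<circ> \<phi>) \<le> ereal L"
  shows "Lpt0 V (f \<circ> \<psi>) \<le> ereal L"
  unfolding Lpt0_le_iff
proof (intro allI impI)
  fix K assume K: "K > L"
  obtain r \<tau> where \<tau>: "r > 0" "ball 0 r \<subseteq> V" "\<tau> 0 = 0"
    "\<And>x. x \<in> ball 0 r \<Longrightarrow> \<tau> x \<in> U \<and> \<phi> (\<tau> x) = \<psi> x"
    "\<And>x y. x \<in> ball 0 r \<Longrightarrow> y \<in> ball 0 r \<Longrightarrow> norm (\<tau> x - \<tau> y) \<le> norm (x - y)"
    using transition_lipschitz[OF A c d] by blast
  obtain s where s: "s > 0"
    "\<And>x. x \<in> U \<Longrightarrow> norm x < s \<Longrightarrow> \<bar>f (\<phi> x) - f (\<phi> 0)\<bar> \<le> K * norm x"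
    using le[unfolded Lpt0_le_iff] K by (auto simp: comp_def)
  show "\<exists>r>0. \<forall>x\<in>V. norm x < r \<longrightarrow> \<bar>(f \<circ> \<psi>) x - (f \<circ> \<psi>) 0\<bar> \<le> K * norm x"
  proof (intro exI[of _ "min r s"] conjI ballI impI)
    fix x assume x: "x \<in> V" "norm x < min r s"
    then have b: "x \<in> ball 0 r" "0 \<in> ball 0 r" using \<tau>(1) by auto
    have n: "norm (\<tau> x) \<le> norm x" using \<tau>(5)[OF b] \<tau>(3) by simp
    then have "\<bar>f (\<phi> (\<tau> x)) - f (\<phi> 0)\<bar> \<le> K * norm (\<tau> x)"
      using s(2)[of "\<tau> x"] \<tau>(4)[OF b(1)] x by simp
    also have "\<dots> \<le> K * norm x" using n K L by (intro mult_left_mono) auto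
    finally show "\<bar>(f \<circ> \<psi>) x - (f \<circ> \<psi>) 0\<bar> \<le> K * norm x"
      using \<tau>(3) \<tau>(4)[OF b(1)] \<tau>(4)[OF b(2)] by simp
  qed (use \<tau> s in simp)
qed

lemma Lloc0_le_change_chart:
  assumes A: "flat_atlas M A" and c: "(U, \<phi>) \<in> charts_at A p" and d: "(V, \<psi>) \<in> charts_at A p"
    and L: "L \<ge> 0" and le: "Lloc0 U (f \<circ> \<phi>) \<le> ereal L"
  shows "Lloc0 V (f \<circ> \<psi>) \<le> ereal L"
  unfolding Lloc0_le_iff
proof (intro allI impI)
  fix K assume K: "K > L"
  obtain r \<tau> where \<tau>: "r > 0" "ball 0 r \<subseteq> V" "\<tau> 0 = 0"
    "\<And>x. x \<in> ball 0 r \<Longrightarrow> \<tau> x \<in> U \<and> \<phi> (\<tau> x) = \<psi> x"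
    "\<And>x y. x \<in> ball 0 r \<Longrightarrow> y \<in> ball 0 r \<Longrightarrow> norm (\<tau> x - \<tau> y) \<le> norm (x - y)"
    using transition_lipschitz[OF A c d] by blast
  obtain s where s: "s > 0"
    "\<And>x y. x \<in> U \<Longrightarrow> y \<in> U \<Longrightarrow> norm x < s \<Longrightarrow> norm y < s \<Longrightarrow>
      \<bar>f (\<phi> x) - f (\<phi> y)\<bar> \<le> K * norm (x - y)"
    using le[unfolded Lloc0_le_iff, rule_format, OF K] by (auto simp: comp_def)
  show "\<exists>r>0. \<forall>x\<in>V. \<forall>y\<in>V. norm x < r \<longrightarrow> norm y < r \<longrightarrow>
      \<bar>(f \<circ> \<psi>) x - (f \<circ> \<psi>) y\<bar> \<le> K * norm (x - y)"
  proof (intro exI[of _ "min r s"] conjI ballI impI)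
    fix x y assume x: "x \<in> V" "norm x < min r s" and y: "y \<in> V" "norm y < min r s"
    then have b: "x \<in> ball 0 r" "y \<in> ball 0 r" "0 \<in> ball 0 r" using \<tau>(1) by auto
    have "norm (\<tau> x) \<le> norm x" "norm (\<tau> y) \<le> norm y"
      using \<tau>(5)[OF b(1,3)] \<tau>(5)[OF b(2,3)] \<tau>(3) by simp_all
    then have "\<bar>f (\<phi> (\<tau> x)) - f (\<phi> (\<tau> y))\<bar> \<le> K * norm (\<tau> x - \<tau> y)"
      using s(2)[of "\<tau> x" "\<tau> y"] \<tau>(4)[OF b(1)] \<tau>(4)[OF b(2)] x y by simp
    also have "\<dots> \<le> K * norm (x - y)" using \<tau>(5)[OF b(1,2)] K L by (intro mult_left_mono) auto
    finally show "\<bar>(f \<circ> \<psi>) x - (f \<circ> \<psi>) y\<bar> \<le> K * norm (x - y)"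
      using \<tau>(4)[OF b(1)] \<tau>(4)[OF b(2)] by simp
  qed (use \<tau> s in simp)
qed

text \<open>The given chart ensures that \<open>SOME\<close> picks a genuine chart at
  \<open>p\<close>; the two are then compared in both directions.\<close>

lemma Lpt_le_iff:
  assumes "flat_atlas M A" "(U, \<phi>) \<in> charts_at A p" "L \<ge> 0"
  shows "Lpt A p f \<le> ereal L \<longleftrightarrow> Lpt0 U (f \<circ> \<phi>) \<le> ereal L"
proof -
  obtain V \<psi> where V: "(SOME c. c \<in> charts_at A p) = (V, \<psi>)" by fastforce
  then have d: "(V, \<psi>) \<in> charts_at A p"
    using someI[of "\<lambda>c. c \<in> charts_at A p", OF assms(2)] by simp
  have "Lpt A p f = Lpt0 V (f \<circ> \<psi>)" by (simp add: Lpt_def V)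
  then show ?thesis
    using Lpt0_le_change_chart[OF assms(1,2) d assms(3), of f]
      Lpt0_le_change_chart[OF assms(1) d assms(2,3), of f] by auto
qed

lemma Lloc_le_iff:
  assumes "flat_atlas M A" "(U, \<phi>) \<in> charts_at A p" "L \<ge> 0"
  shows "Lloc A p f \<le> ereal L \<longleftrightarrow> Lloc0 U (f \<circ> \<phi>) \<le> ereal L"
proof -
  obtain V \<psi> where V: "(SOME c. c \<in> charts_at A p) = (V, \<psi>)" by fastforce
  then have d: "(V, \<psi>) \<in> charts_at A p"
    using someI[of "\<lambda>c. c \<in> charts_at A p", OF assms(2)] by simp
  have "Lloc A p f = Lloc0 V (f \<circ> \<psi>)" by (simp add: Lloc_def V)
  then show ?thesis
    using Lloc0_le_change_chart[OF assms(1,2) d assms(3), of f]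
      Lloc0_le_change_chart[OF assms(1) d assms(2,3), of f] by auto
qed

section \<open>Bump functions\<close>

text \<open>A cone of height \<open>r\<close> with apex at the centre of the chart: inside radius
  \<open>r\<close> its drop from the apex is exactly the distance to the centre.\<close>

definition bump :: "'a set \<Rightarrow> ('a, 'n::finite) chart \<Rightarrow> real \<Rightarrow> 'a \<Rightarrow> real" where
  "bump M = (\<lambda>(U, \<phi>) r. \<lambda>q\<in>M. if q \<in> \<phi> ` U then max 0 (r - norm (inv_into U \<phi> q)) else 0)"

lemma bump_chart:
  assumes "is_chart M (U, \<phi>)" "x \<in> U"
  shows "bump M (U, \<phi>) r (\<phi> x) = max 0 (r - norm x)"
  using assms by (auto simp: bump_def is_chart_def)

lemma topspace_flat_topology:
  assumes "flat_atlas M A"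
  shows "topspace (flat_topology M A) = M"
proof
  have "openin (flat_topology M A) (topspace (flat_topology M A))" by (rule openin_topspace)
  then show "topspace (flat_topology M A) \<subseteq> M" unfolding openin_flat_topology by blast
  have "open {x \<in> U. \<phi> x \<in> M}" if "(U, \<phi>) \<in> A" for U \<phi>
  proof -
    have "{x \<in> U. \<phi> x \<in> M} = U" "open U"
      using flat_atlas_is_chart[OF assms that] by (auto simp: is_chart_def)
    then show ?thesis by simp
  qed
  then have "openin (flat_topology M A) M"
    unfolding openin_flat_topology by blast
  then show "M \<subseteq> topspace (flat_topology M A)" by (rule openin_subset)
qed

lemma continuous_map_chart:
  assumes A: "flat_atlas M A" and c: "(U, \<phi>) \<in> A"
  shows "continuous_map (top_of_set U) (flat_topology M A) \<phi>"
  unfolding continuous_map_def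
proof (intro conjI allI impI)
  have U: "\<phi> \<in> U \<rightarrow> M" "open U"
    using flat_atlas_is_chart[OF A c] by (auto simp: is_chart_def)
  then show "\<phi> \<in> topspace (top_of_set U) \<rightarrow> topspace (flat_topology M A)"
    by (simp add: topspace_flat_topology[OF A])
  fix S assume "openin (flat_topology M A) S"
  then have "open {x \<in> U. \<phi> x \<in> S}" using c unfolding openin_flat_topology by blast
  then show "openin (top_of_set U) {x \<in> topspace (top_of_set U). \<phi> x \<in> S}"
    using U(2) by (auto simp: openin_open_eq)
qed

text \<open>The only use of the Hausdorff property: it makes bump functions continuous
  at the boundary of the chart that carries them.\<close>

lemma closedin_chart_cball:
  assumes M: "flat_manifold M A" and c: "(U, \<phi>) \<in> A" and r: "cball 0 r \<subseteq> U"
  shows "closedin (flat_topology M A) (\<phi> ` cball 0 r)"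
proof (rule compactin_imp_closedin)
  show "Hausdorff_space (flat_topology M A)" using M by (simp add: flat_manifold_def)
  have "compactin (top_of_set U) (cball 0 r)"
    using r by (simp add: compactin_subtopology)
  moreover have "flat_atlas M A" using M by (simp add: flat_manifold_def)
  ultimately show "compactin (flat_topology M A) (\<phi> ` cball 0 r)"
    using image_compactin continuous_map_chart c by blast
qed

text \<open>Inside the carrying chart the cone is 1-Lipschitz by the reverse triangle inequality,
  and the bound is transported to other charts. At any other point the function vanishes
  nearby.\<close>

lemma Lloc0_bump_le:
  fixes A :: "('a, 'n::finite) chart set"
  assumes M: "flat_manifold M A" and c: "(U, \<phi>) \<in> A" and r: "cball 0 r \<subseteq> U"
    and d: "(V, \<psi>) \<in> charts_at A p"
  shows "Lloc0 V (bump M (U, \<phi>) r \<circ> \<psi>) \<le> ereal 1"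
proof (cases "p \<in> \<phi> ` U")
  case True
  have A: "flat_atlas M A" using M by (simp add: flat_manifold_def)
  obtain a where a: "a \<in> U" "p = \<phi> a" using True by blast
  have bc: "bump M (U, \<phi>) r (\<phi> x) = max 0 (r - norm x)" if "x \<in> U" for x
    using bump_chart[OF flat_atlas_is_chart[OF A c] that] .
  have "Lloc0 {x. x + a \<in> U} (bump M (U, \<phi>) r \<circ> (\<lambda>x. \<phi> (x + a))) \<le> ereal 1"
    unfolding Lloc0_le_iff
  \<comment> \<open>The estimate holds on the whole domain, so the radius 1 is arbitrary.\<close>
  proof (intro allI impI exI[of _ 1] conjI ballI)
    fix K :: real and x y
    assume K: "K > 1" and x: "x \<in> {x. x + a \<in> U}" and y: "y \<in> {x. x + a \<in> U}"
    have "\<bar>max 0 (r - norm (x + a)) - max 0 (r - norm (y + a))\<bar> \<le> \<bar>norm (x + a) - norm (y + a)\<bar>"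
      by (auto simp: max_def)
    also have "\<dots> \<le> norm (x - y)" using norm_triangle_ineq3[of "x + a" "y + a"] by simp
    also have "\<dots> \<le> K * norm (x - y)" using K mult_right_mono[of 1 K "norm (x - y)"] by simp
    finally show "\<bar>(bump M (U, \<phi>) r \<circ> (\<lambda>x. \<phi> (x + a))) x - (bump M (U, \<phi>) r \<circ> (\<lambda>x. \<phi> (x + a))) y\<bar>
        \<le> K * norm (x - y)"
      using x y by (simp add: bc)
  qed simp
  then show ?thesis
    using Lloc0_le_change_chart[OF A shift_chart_in_charts_at[OF A c a(1)]] d a(2) by simp
next
  case False
  have A: "flat_atlas M A" using M by (simp add: flat_manifold_def)
  have dA: "(V, \<psi>) \<in> A" "\<psi> 0 = p" using d by (auto simp: charts_at_def)
  have V: "0 \<in> V" "\<And>x. x \<in> V \<Longrightarrow> \<psi> x \<in> M"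
    using flat_atlas_is_chart[OF A dA(1)] by (auto simp: is_chart_def)
  have inj: "inj_on \<phi> U" using flat_atlas_is_chart[OF A c] by (simp add: is_chart_def)
  \<comment> \<open>The complement of the closed ball image is an open neighbourhood of
    \<open>p\<close>. Its points are either outside the carrying chart or at radius above
    \<open>r\<close>, and the cone is 0 in both cases.\<close>
  have "openin (flat_topology M A) (M - \<phi> ` cball 0 r)"
    using closedin_chart_cball[OF M c r] by (simp add: closedin_def topspace_flat_topology[OF A])
  then have op: "open {x \<in> V. \<psi> x \<in> M - \<phi> ` cball 0 r}"
    using dA unfolding openin_flat_topology by blast
  have "\<psi> 0 \<notin> \<phi> ` cball 0 r" using False dA(2) r by auto
  then have "0 \<in> {x \<in> V. \<psi> x \<in> M - \<phi> ` cball 0 r}" using V by simp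
  then obtain s where s: "s > 0" "ball 0 s \<subseteq> {x \<in> V. \<psi> x \<in> M - \<phi> ` cball 0 r}"
    using op open_contains_ball by blast
  have zero: "bump M (U, \<phi>) r (\<psi> x) = 0" if x: "norm x < s" for x
  proof (cases "\<psi> x \<in> \<phi> ` U")
    case True
    then obtain u where u: "u \<in> U" "\<psi> x = \<phi> u" by blast
    have "\<psi> x \<notin> \<phi> ` cball 0 r" using s(2) x by (auto simp: subset_iff)
    then have "u \<notin> cball 0 r" using u by blast
    then have "norm u > r" by simp
    then show ?thesis using bump_chart[OF flat_atlas_is_chart[OF A c] u(1)] u(2) by simp
  next
    case False
    moreover have "\<psi> x \<in> M" using s(2) x by (auto simp: subset_iff)
    ultimately show ?thesis by (simp add: bump_def)
  qed
  show ?thesis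
    unfolding Lloc0_le_iff
    using s(1) zero by (intro allI impI exI[of _ s]) simp
qed

text \<open>The properties shared by the pointwise and the local theory that the proof uses:
  there are enough functions of constant at most 1, and the constant bounds the pointwise one.\<close>

definition detects_charts ::
  "'a set \<Rightarrow> ('a, 'n::finite) chart set \<Rightarrow> ('a \<Rightarrow> real) set \<Rightarrow> ('a \<Rightarrow> ('a \<Rightarrow> real) \<Rightarrow> ereal) \<Rightarrow> bool"
  where
  "detects_charts M A E \<Lambda> \<longleftrightarrow>
     (\<forall>(U, \<phi>)\<in>A. \<forall>r>0. cball 0 r \<subseteq> U \<longrightarrow> bump M (U, \<phi>) r \<in> E \<and> \<Lambda> (\<phi> 0) (bump M (U, \<phi>) r) \<le> 1) \<and>
     (\<forall>p. \<forall>(U, \<phi>)\<in>charts_at A p. \<forall>f. \<Lambda> p f \<le> 1 \<longrightarrow> Lpt0 U (f \<circ> \<phi>) \<le> 1)"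

lemma
  assumes "detects_charts M A E \<Lambda>"
  shows detects_charts_bumpD: "(U, \<phi>) \<in> A \<Longrightarrow> r > 0 \<Longrightarrow> cball 0 r \<subseteq> U \<Longrightarrow>
      bump M (U, \<phi>) r \<in> E \<and> \<Lambda> (\<phi> 0) (bump M (U, \<phi>) r) \<le> 1"
    and detects_charts_Lpt0D: "(U, \<phi>) \<in> charts_at A p \<Longrightarrow> \<Lambda> p f \<le> 1 \<Longrightarrow> Lpt0 U (f \<circ> \<phi>) \<le> 1"
  using assms by (force simp: detects_charts_def)+

lemma detects_charts_loc:
  assumes M: "flat_manifold M A"
  shows "detects_charts M A (Lip_loc M A) (Lloc A)"
proof -
  have A: "flat_atlas M A" using M by (simp add: flat_manifold_def)
  have "bump M (U, \<phi>) r \<in> Lip_loc M A" if c: "(U, \<phi>) \<in> A" "cball 0 r \<subseteq> U" for U \<phi> r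
  proof -
    have "\<exists>(V, \<psi>)\<in>charts_at A p. Lloc0 V (bump M (U, \<phi>) r \<circ> \<psi>) < \<infinity>" if p: "p \<in> M" for p
    proof -
      obtain V \<psi> where d: "(V, \<psi>) \<in> charts_at A p" using charts_at_nonempty[OF A p] by auto
      then have "Lloc0 V (bump M (U, \<phi>) r \<circ> \<psi>) \<le> ereal 1" by (rule Lloc0_bump_le[OF M c])
      then have "Lloc0 V (bump M (U, \<phi>) r \<circ> \<psi>) < \<infinity>" by (rule le_less_trans) simp
      then show ?thesis using d by blast
    qed
    then show ?thesis by (simp add: Lip_loc_def bump_def)
  qed
  moreover have "Lloc A (\<phi> 0) (bump M (U, \<phi>) r) \<le> 1" if c: "(U, \<phi>) \<in> A" "cball 0 r \<subseteq> U" for U \<phi> r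
  proof -
    have d: "(U, \<phi>) \<in> charts_at A (\<phi> 0)" using c by (simp add: charts_at_def)
    show ?thesis
      using Lloc_le_iff[OF A d, of 1 "bump M (U, \<phi>) r"] Lloc0_bump_le[OF M c d]
      by (simp add: one_ereal_def)
  qed
  moreover have "Lpt0 U (f \<circ> \<phi>) \<le> 1" if d: "(U, \<phi>) \<in> charts_at A p" and "Lloc A p f \<le> 1" for p U \<phi> f
  proof -
    have "0 \<in> U" using d flat_atlas_is_chart[OF A] by (auto simp: charts_at_def is_chart_def)
    then show ?thesis
      using Lloc_le_iff[OF A d, of 1 f] Lpt0_le_if_Lloc0_le[of U "f \<circ> \<phi>" 1] that(2)
      by (simp add: one_ereal_def)
  qed
  ultimately show ?thesis unfolding detects_charts_def by blast
qed

lemma detects_charts_pt: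
  assumes M: "flat_manifold M A"
  shows "detects_charts M A (Lip_pt M A) (Lpt A)"
proof -
  have A: "flat_atlas M A" using M by (simp add: flat_manifold_def)
  have pt: "Lpt0 V (bump M (U, \<phi>) r \<circ> \<psi>) \<le> ereal 1"
    if c: "(U, \<phi>) \<in> A" "cball 0 r \<subseteq> U" and d: "(V, \<psi>) \<in> charts_at A p" for U \<phi> r V \<psi> p
  proof (rule Lpt0_le_if_Lloc0_le[OF Lloc0_bump_le[OF M c d]])
    show "0 \<in> V" using d flat_atlas_is_chart[OF A] by (auto simp: charts_at_def is_chart_def)
  qed
  have "bump M (U, \<phi>) r \<in> Lip_pt M A" if c: "(U, \<phi>) \<in> A" "cball 0 r \<subseteq> U" for U \<phi> r
  proof -
    have "\<exists>(V, \<psi>)\<in>charts_at A p. Lpt0 V (bump M (U, \<phi>) r \<circ> \<psi>) < \<infinity>" if p: "p \<in> M" for p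
    proof -
      obtain V \<psi> where d: "(V, \<psi>) \<in> charts_at A p" using charts_at_nonempty[OF A p] by auto
      then have "Lpt0 V (bump M (U, \<phi>) r \<circ> \<psi>) < \<infinity>" by (intro le_less_trans[OF pt[OF c]]) simp_all
      then show ?thesis using d by blast
    qed
    then show ?thesis by (simp add: Lip_pt_def bump_def)
  qed
  moreover have "Lpt A (\<phi> 0) (bump M (U, \<phi>) r) \<le> 1" if c: "(U, \<phi>) \<in> A" "cball 0 r \<subseteq> U" for U \<phi> r
  proof -
    have d: "(U, \<phi>) \<in> charts_at A (\<phi> 0)" using c by (simp add: charts_at_def)
    show ?thesis
      using Lpt_le_iff[OF A d, of 1 "bump M (U, \<phi>) r"] pt[OF c d] by (simp add: one_ereal_def)
  qed
  moreover have "Lpt0 U (f \<circ> \<phi>) \<le> 1" if d: "(U, \<phi>) \<in> charts_at A p" and "Lpt A p f \<le> 1" for p U \<phi> f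
    using Lpt_le_iff[OF A d, of 1 f] that(2) by (simp add: one_ereal_def)
  ultimately show ?thesis unfolding detects_charts_def by blast
qed

text \<open>The bump is built in the chart recentred at \<open>a\<close>. That chart has the same
  image and translations preserve distance, so in the original chart the formula holds on all of
  \<open>U\<close>.\<close>

lemma detects_charts_bump:
  fixes A :: "('a, 'n::finite) chart set"
  assumes E: "detects_charts M A E \<Lambda>" and A: "flat_atlas M A" and c: "(U, \<phi>) \<in> A" and a: "a \<in> U"
  obtains r b where "r > 0" "b \<in> E" "\<Lambda> (\<phi> a) b \<le> 1"
    "\<And>x. x \<in> U \<Longrightarrow> b (\<phi> x) = max 0 (r - dist x a)"
proof -
  let ?U = "{x. x + a \<in> U}" and ?\<phi> = "\<lambda>x. \<phi> (x + a)"
  have c': "(?U, ?\<phi>) \<in> A"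
    using flat_atlas_shift[OF A c a] by (simp add: shift_chart_def)
  have ch: "is_chart M (?U, ?\<phi>)" by (rule flat_atlas_is_chart[OF A c'])
  then have "open ?U" "0 \<in> ?U" by (simp_all add: is_chart_def)
  then obtain r where r: "r > 0" "cball 0 r \<subseteq> ?U"
    unfolding open_contains_cball by blast
  show thesis
  proof (rule that[OF r(1), of "bump M (?U, ?\<phi>) r"])
    have "bump M (?U, ?\<phi>) r \<in> E \<and> \<Lambda> (?\<phi> 0) (bump M (?U, ?\<phi>) r) \<le> 1"
      by (rule detects_charts_bumpD[OF E c' r])
    then show "bump M (?U, ?\<phi>) r \<in> E" "\<Lambda> (\<phi> a) (bump M (?U, ?\<phi>) r) \<le> 1" by simp_all
    show "bump M (?U, ?\<phi>) r (\<phi> x) = max 0 (r - dist x a)" if "x \<in> U" for x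
      using bump_chart[OF ch, of "x - a" r] that by (simp add: dist_norm)
  qed
qed

text \<open>Recentring at \<open>a\<close> turns the estimate at the origin into one at an arbitrary
  point of a fixed chart.\<close>

lemma detects_charts_dilation:
  assumes E: "detects_charts M A E \<Lambda>" and A: "flat_atlas M A" and c: "(U, \<phi>) \<in> A" and a: "a \<in> U"
    and f: "\<Lambda> (\<phi> a) f \<le> 1"
  shows "dilation_le_at U (f \<circ> \<phi>) a 1"
  unfolding dilation_le_at_def
proof (intro allI impI)
  fix K :: real assume K: "K > 1"
  have "Lpt0 {x. x + a \<in> U} (f \<circ> (\<lambda>x. \<phi> (x + a))) \<le> ereal 1"
    using detects_charts_Lpt0D[OF E shift_chart_in_charts_at[OF A c a] f] by (simp add: one_ereal_def)
  then obtain r where r: "r > 0"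
    "\<And>x. x + a \<in> U \<Longrightarrow> norm x < r \<Longrightarrow> \<bar>f (\<phi> (x + a)) - f (\<phi> a)\<bar> \<le> K * norm x"
    using K unfolding Lpt0_le_iff by auto
  show "\<exists>r>0. \<forall>y\<in>U. dist y a < r \<longrightarrow> dist ((f \<circ> \<phi>) y) ((f \<circ> \<phi>) a) \<le> K * dist y a"
    using r(1) r(2)[of "y - a" for y] by (intro exI[of _ r]) (simp add: dist_norm)
qed

section \<open>From the composition operator to the isometry\<close>

text \<open>Keeping \<open>E\<close> and \<open>\<Lambda>\<close> abstract serves the pointwise and
  the local case at once. Cones on the \<open>M\<close> side, pulled back, bound the dilation of
  \<open>h\<close> from above; cones on the \<open>N\<close> side, written as compositions, bound it
  from below.\<close>

lemma flat_local_isometryI: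
  fixes A :: "('a, 'n::finite) chart set" and B :: "('b, 'n) chart set"
  assumes A: "flat_atlas M A" and B: "flat_atlas N B"
    and E: "detects_charts M A E \<Lambda>" and F: "detects_charts N B F \<Lambda>'"
    and T: "composition_operator N \<sigma> ` E = F"
    and eq: "\<And>f x. f \<in> E \<Longrightarrow> x \<in> N \<Longrightarrow> \<Lambda>' x (composition_operator N \<sigma> f) = \<Lambda> (\<sigma> x) f"
  shows "flat_local_isometry N B A \<sigma>"
  unfolding flat_local_isometry_def
proof (clarify)
  fix p U \<phi> V \<psi>
  assume "(U, \<phi>) \<in> charts_at A (\<sigma> p)" "(V, \<psi>) \<in> charts_at B p" and sub: "\<sigma> ` \<psi> ` V \<subseteq> \<phi> ` U"
  then have c: "(U, \<phi>) \<in> A" and d: "(V, \<psi>) \<in> B" by (auto simp: charts_at_def)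
  define h where "h = inv_into U \<phi> \<circ> \<sigma> \<circ> \<psi>"
  have V: "open V" "connected V" "inj_on \<psi> V" and VN: "\<And>x. x \<in> V \<Longrightarrow> \<psi> x \<in> N"
    using flat_atlas_is_chart[OF B d] by (auto simp: is_chart_def)
  have hU: "h x \<in> U" and \<phi>h: "\<phi> (h x) = \<sigma> (\<psi> x)" if "x \<in> V" for x
    using sub that by (auto simp: h_def inv_into_into f_inv_into_f image_subset_iff)
  have upper: "dilation_le_at V h x 1" if x: "x \<in> V" for x
    unfolding dilation_le_at_def
  proof (intro allI impI)
    fix K :: real assume K: "K > 1"
    obtain r b where b: "r > 0" "b \<in> E" "\<Lambda> (\<phi> (h x)) b \<le> 1"
      "\<And>z. z \<in> U \<Longrightarrow> b (\<phi> z) = max 0 (r - dist z (h x))"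
      using detects_charts_bump[OF E A c hU[OF x]] by blast
    have "\<Lambda>' (\<psi> x) (composition_operator N \<sigma> b) \<le> 1"
      using eq[OF b(2) VN[OF x]] b(3) \<phi>h[OF x] by simp
    from detects_charts_dilation[OF F B d x this] obtain s where s: "s > 0"
      "\<And>y. y \<in> V \<Longrightarrow> dist y x < s \<Longrightarrow>
        \<bar>composition_operator N \<sigma> b (\<psi> y) - composition_operator N \<sigma> b (\<psi> x)\<bar> \<le> K * dist y x"
      using K unfolding dilation_le_at_def by (auto simp: dist_real_def)
    have bh: "composition_operator N \<sigma> b (\<psi> y) = max 0 (r - dist (h y) (h x))" if "y \<in> V" for y
      using b(4)[OF hU[OF that]] \<phi>h[OF that] VN[OF that] by (simp add: composition_operator_def)
    \<comment> \<open>The radius \<open>r / K\<close> rules out jumps of \<open>h\<close>: were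
      \<open>h y\<close> at distance at least \<open>r\<close> from \<open>h x\<close>, the cone
      would drop by the full \<open>r\<close>, more than the allowed
      \<open>K * dist y x\<close>.\<close>
    show "\<exists>r>0. \<forall>y\<in>V. dist y x < r \<longrightarrow> dist (h y) (h x) \<le> K * dist y x"
    proof (intro exI[of _ "min s (r / K)"] conjI ballI impI)
      show "min s (r / K) > 0" using s(1) b(1) K by simp
      fix y assume y: "y \<in> V" "dist y x < min s (r / K)"
      then have "K * dist y x < r" using K by (simp add: pos_less_divide_eq mult.commute)
      moreover have "\<bar>max 0 (r - dist (h y) (h x)) - r\<bar> \<le> K * dist y x"
        using s(2)[OF y(1)] y bh[OF y(1)] bh[OF x] b(1) by simp
      ultimately show "dist (h y) (h x) \<le> K * dist y x" by (auto simp: max_def split: if_splits)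
    qed
  qed
  have lower: "\<exists>f r. r > 0 \<and> f \<in> E \<and> \<Lambda> (\<phi> (h x)) f \<le> 1 \<and> (\<forall>y\<in>V. f (\<phi> (h y)) = max 0 (r - dist y x))"
    if x: "x \<in> V" for x
  proof -
    obtain r b where b: "r > 0" "b \<in> F" "\<Lambda>' (\<psi> x) b \<le> 1"
      "\<And>y. y \<in> V \<Longrightarrow> b (\<psi> y) = max 0 (r - dist y x)"
      using detects_charts_bump[OF F B d x] by blast
    \<comment> \<open>Surjectivity of the operator: the cone about \<open>x\<close> factors through
      \<sigma>, hence on \<open>V\<close> through \<open>h\<close>.\<close>
    obtain f where f: "f \<in> E" "b = composition_operator N \<sigma> f" using T b(2) by blast
    have "f (\<phi> (h y)) = b (\<psi> y)" if "y \<in> V" for y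
      using \<phi>h[OF that] VN[OF that] f(2) by (simp add: composition_operator_def)
    then show ?thesis using b f eq[OF f(1) VN[OF x]] \<phi>h[OF x] by (intro exI[of _ f] exI[of _ r]) auto
  qed
  have inj: "inj_on h V"
  proof (rule inj_onI)
    fix x y assume x: "x \<in> V" and y: "y \<in> V" and "h x = h y"
    obtain f r where f: "r > 0" "\<forall>y\<in>V. f (\<phi> (h y)) = max 0 (r - dist y x)" using lower[OF x] by blast
    \<comment> \<open>The cone takes its value \<open>r > 0\<close> only at its apex, so equal
      images force \<open>y = x\<close>.\<close>
    have "max 0 (r - dist y x) = max 0 (r - dist x x)"
      using f(2) x y \<open>h x = h y\<close> by metis
    then show "x = y" using f(1) by (auto simp: max_def split: if_splits)
  qed
  have low: "\<exists>r>0. \<forall>y\<in>V. dist y x < r \<longrightarrow> dist y x \<le> K * dist (h y) (h x)"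
    if x: "x \<in> V" and K: "K > 1" for x K
  proof -
    obtain f r where f: "r > 0" "\<Lambda> (\<phi> (h x)) f \<le> 1" "\<And>y. y \<in> V \<Longrightarrow> f (\<phi> (h y)) = max 0 (r - dist y x)"
      using lower[OF x] by blast
    from detects_charts_dilation[OF E A c hU[OF x] f(2)] obtain s where s: "s > 0"
      "\<And>z. z \<in> U \<Longrightarrow> dist z (h x) < s \<Longrightarrow> \<bar>f (\<phi> z) - f (\<phi> (h x))\<bar> \<le> K * dist z (h x)"
      using K unfolding dilation_le_at_def by (auto simp: dist_real_def)
    obtain t where t: "t > 0" "\<And>y. y \<in> V \<Longrightarrow> dist y x < t \<Longrightarrow> dist (h y) (h x) \<le> 2 * dist y x"
      using upper[OF x, unfolded dilation_le_at_def, rule_format, of 2] by auto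
    show ?thesis
    \<comment> \<open>Within \<open>t\<close> the upper bound with factor 2 applies, and
      \<open>s / 2\<close> then brings \<open>h y\<close> within \<open>s\<close> of
      \<open>h x\<close>. The radius \<open>r\<close> keeps the cone untruncated, so
      \<open>f\<close> drops by exactly \<open>dist y x\<close>.\<close>
    proof (intro exI[of _ "min (s / 2) (min t r)"] conjI ballI impI)
      show "min (s / 2) (min t r) > 0" using s t f by simp
      fix y assume y: "y \<in> V" "dist y x < min (s / 2) (min t r)"
      then have "dist (h y) (h x) < s" using t(2)[OF y(1)] by linarith
      then have "\<bar>f (\<phi> (h y)) - f (\<phi> (h x))\<bar> \<le> K * dist (h y) (h x)" by (rule s(2)[OF hU[OF y(1)]])
      then show "dist y x \<le> K * dist (h y) (h x)" using y f(1) by (simp add: f(3)[OF y(1)] f(3)[OF x])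
    qed
  qed
  have "isometry V U h"
    unfolding isometry_def
    using hU infinitesimal_isometry_imp_isometry[OF V(1,2) inj upper low] by blast
  then show "isometry V U (inv_into U \<phi> \<circ> \<sigma> \<circ> \<psi>)" by (simp add: h_def)
qed

theorem theorem4p3:
  fixes M :: "'a set" and A :: "('a, 'n::finite) chart set"
    and N :: "'b set" and B :: "('b, 'n) chart set"
    and \<sigma> :: "'b \<Rightarrow> 'a"
  assumes "flat_manifold M A" and "flat_manifold N B"
    and "\<sigma> \<in> N \<rightarrow> M"
  shows "(bijective_linear M N (Lip_pt M A) (Lip_pt N B) (composition_operator N \<sigma>) \<and>
           (\<forall>f\<in>Lip_pt M A. \<forall>x\<in>N. Lpt B x (composition_operator N \<sigma> f) = Lpt A (\<sigma> x) f)
         \<longrightarrow> flat_local_isometry N B A \<sigma>)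
       \<and> (bijective_linear M N (Lip_loc M A) (Lip_loc N B) (composition_operator N \<sigma>) \<and>
           (\<forall>f\<in>Lip_loc M A. \<forall>x\<in>N. Lloc B x (composition_operator N \<sigma> f) = Lloc A (\<sigma> x) f)
         \<longrightarrow> flat_local_isometry N B A \<sigma>)"
proof -
  have A: "flat_atlas M A" "flat_atlas N B" using assms by (simp_all add: flat_manifold_def)
  show ?thesis
    \<comment> \<open>Unfolding \<open>bij_betw\<close> yields the image equation for the
      composition operator, once for each kind of Lipschitz space.\<close>
    using flat_local_isometryI[OF A detects_charts_pt[OF assms(1)] detects_charts_pt[OF assms(2)]]
      flat_local_isometryI[OF A detects_charts_loc[OF assms(1)] detects_charts_loc[OF assms(2)]]
    by (simp add: bijective_linear_def bij_betw_def)
qed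

end
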